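(* Let $v>0$ be known, let $\lambda_0>0$ be the true value of the rate, and let $\{X(t), t\geq 0\}$ be the telegraph process with velocity $v$ and rate $\lambda_0$, observed at the times $i\Delta_n$, $i=0,1,\ldots,n$, where $\Delta_n>0$. Let $\eta_i=X(i\Delta_n)-X((i-1)\Delta_n)$, $i=1,\ldots,n$, and let $\check\lambda_n$ be the moment type estimator, i.e. the solution $\lambda=\check\lambda_n$ of $$ \frac1n\sum_{i=1}^n\eta_i^2-\frac{v^2}{\lambda}\left(\Delta_n-\frac{1-e^{-2\lambda\Delta_n}}{2\lambda}\right)=0 . $$ Let $n\Delta_n\to\infty$ and $\Delta_n\to 0$ as $n\to\infty$. Then $\check\lambda_n$ is a consistent estimator of $\lambda_0$ and is such that $$ \sqrt{n\Delta_n}\,(\check\lambda_n-\lambda_0)\overset{d}{\longrightarrow}N\left(0,\tfrac65\lambda_0\right), $$ where $\overset{d}{\to}$ denotes convergence in distribution.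
   Context: The telegraph process with velocity $v>0$ and rate $\lambda_0>0$ is defined by $$X(t)=V(0)\int_0^t(-1)^{N(s)}\,\mathrm{d}s,\qquad t> 0,$$ with $X(0)=0$, where $\{N(t),t> 0\}$ is a homogeneous Poisson process with rate $\lambda_0$, and $V(0)$ is the initial velocity, independent of $N$, taking the values $+v$ and $-v$ with equal probability. *)

theory Defs
  imports "HOL-Probability.Probability"
begin

text \<open>
  A homogeneous Poisson process as a counting process: every path starts at 0, is nondecreasing and
  right-continuous (in the discrete topology of \<^typ>\<open>nat\<close>), and increments over consecutive
  intervals are independent and Poisson distributed. As paths are nondecreasing, the truncated
  subtraction on \<^typ>\<open>nat\<close> is the ordinary one here. Only times \<open>t \<ge> 0\<close> matter.
\<close>

locale poisson_process = prob_space M for M :: "'a measure" +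
  fixes rate :: real and N :: "real \<Rightarrow> 'a \<Rightarrow> nat"
  assumes rate_pos: "rate > 0"
    and N_measurable: "\<And>t. 0 \<le> t \<Longrightarrow> N t \<in> measurable M (count_space UNIV)"
    and N_zero: "\<And>\<omega>. \<omega> \<in> space M \<Longrightarrow> N 0 \<omega> = 0"
    and N_mono: "\<And>\<omega> s t. \<omega> \<in> space M \<Longrightarrow> 0 \<le> s \<Longrightarrow> s \<le> t \<Longrightarrow> N s \<omega> \<le> N t \<omega>"
    and N_right_continuous:
      "\<And>\<omega> t. \<omega> \<in> space M \<Longrightarrow> 0 \<le> t \<Longrightarrow> continuous (at_right t) (\<lambda>s. N s \<omega>)"
    and N_increment_distr: "\<And>s t. 0 \<le> s \<Longrightarrow> s < t \<Longrightarrow>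
      distr M (count_space UNIV) (\<lambda>\<omega>. N t \<omega> - N s \<omega>) = measure_pmf (poisson_pmf (rate * (t - s)))"
    and N_indep_increments: "\<And>(t :: nat \<Rightarrow> real) k. 0 \<le> t 0 \<Longrightarrow> mono t \<Longrightarrow>
      indep_vars (\<lambda>_. count_space UNIV) (\<lambda>i \<omega>. N (t (Suc i)) \<omega> - N (t i) \<omega>) {..<k}"

text \<open>
  \<open>V0_indep\<close> makes the generated sigma-algebras independent, with the whole family \<open>(N t)\<close>, \<open>t \<ge> 0\<close>,
  seen as one random element of the product space; the library's \<open>indep_var\<close> would need both
  random elements to have values in the same type.
\<close>

locale telegraph_process = poisson_process M rate N
  for M :: "'a measure" and rate :: real and N :: "real \<Rightarrow> 'a \<Rightarrow> nat" +
  fixes v :: real and V0 :: "'a \<Rightarrow> real" and X :: "real \<Rightarrow> 'a \<Rightarrow> real"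
  assumes v_pos: "v > 0"
    and V0_measurable: "V0 \<in> borel_measurable M"
    and V0_plus: "prob {\<omega> \<in> space M. V0 \<omega> = v} = 1 / 2"
    and V0_minus: "prob {\<omega> \<in> space M. V0 \<omega> = - v} = 1 / 2"
    and V0_indep: "indep_set
      (sets (vimage_algebra (space M) V0 borel))
      (sets (vimage_algebra (space M) (\<lambda>\<omega>. \<lambda>t\<in>{0..}. N t \<omega>)
        (PiM {0..} (\<lambda>_. count_space UNIV))))"
    and X_eq: "\<And>t \<omega>. 0 \<le> t \<Longrightarrow> \<omega> \<in> space M \<Longrightarrow>
      X t \<omega> = V0 \<omega> * (LBINT s:{0..t}. (-1) ^ N s \<omega>)"

definition moment_equation :: "real \<Rightarrow> real \<Rightarrow> nat \<Rightarrow> (nat \<Rightarrow> real) \<Rightarrow> real \<Rightarrow> bool" where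
  "moment_equation v D n \<eta> l \<longleftrightarrow>
     1 / real n * (\<Sum>i=1..n. (\<eta> i)\<^sup>2)
       - v\<^sup>2 / l * (D - (1 - exp (- 2 * l * D)) / (2 * l)) = 0"

text \<open>
  A positive root of the moment equation need not exist: there is none when the velocity never
  switches (each squared increment is then \<open>(v * D)\<^sup>2\<close>, the limit of the model moment at rate 0).
  The estimator is a random variable that is a positive root whenever there is one; its value on
  the remaining samples is left arbitrary.
\<close>

definition moment_type_estimator ::
  "'a measure \<Rightarrow> real \<Rightarrow> real \<Rightarrow> nat \<Rightarrow> (nat \<Rightarrow> 'a \<Rightarrow> real) \<Rightarrow> ('a \<Rightarrow> real) \<Rightarrow> bool" where
  "moment_type_estimator M v D n \<eta> est \<longleftrightarrow>
     est \<in> borel_measurable M \<and>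
     (\<forall>\<omega>\<in>space M. (\<exists>l>0. moment_equation v D n (\<lambda>i. \<eta> i \<omega>) l) \<longrightarrow>
        est \<omega> > 0 \<and> moment_equation v D n (\<lambda>i. \<eta> i \<omega>) (est \<omega>))"

definition consistent_estimator :: "'a measure \<Rightarrow> (nat \<Rightarrow> 'a \<Rightarrow> real) \<Rightarrow> real \<Rightarrow> bool" where
  "consistent_estimator M est \<theta> \<longleftrightarrow>
     (\<forall>\<epsilon>>0. (\<lambda>n. measure M {\<omega> \<in> space M. \<bar>est n \<omega> - \<theta>\<bar> > \<epsilon>}) \<longlonglongrightarrow> 0)"

end

(*
  Put Z_i = 1 - (eta_i / (v Delta))^2, which lies in [0, 1]. Since V(0)^2 = v^2 almost surely, Z_i
  depends only on the increments of N over the i-th interval, so the Z_i are i.i.d., and the moment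
  equation reads phi(lambda Delta) = mean of the Z_i with phi an increasing bijection from (0, oo)
  to (0, 1) and phi'(0+) = 2/3. To first order in Delta at most one jump occurs in an interval, at a
  uniform time U Delta, and then Z_i = 1 - (2 U - 1)^2; hence Var Z_i ~ (8/15) lambda_0 Delta. As the
  Z_i are bounded and n Delta -> oo, the characteristic function of the normalised sum of the Z_i
  converges to that of N(0, 1). The event {estimator <= y} is {mean of the Z_i <= phi(y Delta)} up to
  the asymptotically negligible event that the mean is 0 or 1, so the distribution functions of
  the estimator converge, with limit variance (3/2)^2 * (8/15) * lambda_0 = (6/5) * lambda_0.
*)
theory Submission
  imports Defs "HOL-Real_Asymp.Real_Asymp"
begin

section \<open>The moment function\<close>

text \<open>The law of \<open>Z_i\<close> changes with \<open>n\<close>, so the rows form a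
  triangular array. The characteristic function of one centred summand is therefore expanded to
  second order. A summand bounded by 1 has its third absolute moment bounded by its variance, so the
  remainder summed over a row is of order \<open>1 / sqrt (n * Delta)\<close>; this is one place
  where the growth of \<open>n * Delta\<close> is decisive. The variance may be replaced by the
  second moment because the squared mean is of order \<open>Delta^2\<close>. Independence is
  available only for increments of \<open>N\<close> over finite grids, so the path integrals are
  reached as pointwise limits of Riemann sums. The inverse of phi is never differentiated:
  distribution functions are compared at the moving threshold
  \<open>lambda_0 + x / sqrt (n * Delta)\<close>, and the mean value theorem for phi near 0 turns it
  into a threshold for the sample mean. Continuity of the normal distribution function absorbs the
  movement. Consistency is then a consequence of the weak limit, because the scaling
  \<open>sqrt (n * Delta)\<close> tends to infinity.\<close>

text \<open>\<open>mean_deficit (\<lambda> * \<Delta>)\<close> is the expectation of \<open>1 - (\<eta> / (v * \<Delta>))\<^sup>2\<close> at rate \<open>\<lambda>\<close>.\<close>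

definition mean_deficit :: "real \<Rightarrow> real" where
  "mean_deficit x = 1 - (1 - (1 - exp (- 2 * x)) / (2 * x)) / x"

definition mean_deficit_deriv :: "real \<Rightarrow> real" where
  "mean_deficit_deriv x = (x - 1 + (x + 1) * exp (- 2 * x)) / x ^ 3"

lemma mean_deficit_has_deriv:
  assumes "x > 0"
  shows "(mean_deficit has_real_derivative mean_deficit_deriv x) (at x)"
  unfolding mean_deficit_def[abs_def] mean_deficit_deriv_def using assms
  by (auto intro!: derivative_eq_intros simp: field_simps power2_eq_square power3_eq_cube)

text \<open>The numerator vanishes at 0, and its derivative
  \<open>1 - (1 + 2 * y) * exp (- 2 * y)\<close> is positive for \<open>y > 0\<close>.\<close>

lemma mean_deficit_deriv_pos:
  assumes "x > 0"
  shows "mean_deficit_deriv x > 0"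
proof -
  define k where "k = (\<lambda>x::real. x - 1 + (x + 1) * exp (- 2 * x))"
  have "k 0 < k x"
  proof (rule DERIV_pos_imp_increasing_open[OF assms])
    fix y :: real assume y: "0 < y" "y < x"
    have "(k has_real_derivative 1 - (1 + 2 * y) * exp (- 2 * y)) (at y)"
      unfolding k_def by (auto intro!: derivative_eq_intros simp: algebra_simps)
    moreover have "1 - (1 + 2 * y) * exp (- 2 * y) > 0"
    proof -
      have "1 + 2 * y < exp (2 * y)"
      proof -
        \<comment> \<open>Squaring \<open>1 + y \<le> exp y\<close> leaves a spare
          \<open>y * y\<close>, which makes the required inequality strict.\<close>
        have "(1 + y) * (1 + y) \<le> exp y * exp y"
          using y by (intro mult_mono) auto
        also have "\<dots> = exp (2 * y)" by (simp flip: exp_add)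
        finally show ?thesis using y by (simp add: algebra_simps) (smt (verit) mult_pos_pos)
      qed
      then show ?thesis by (simp add: exp_minus field_simps)
    qed
    ultimately show "\<exists>d. (k has_real_derivative d) (at y) \<and> d > 0" by blast
  qed (auto simp: k_def intro!: continuous_intros)
  then show ?thesis using assms by (simp add: k_def mean_deficit_deriv_def)
qed

lemma mean_deficit_strict_mono:
  assumes "0 < x" "x < y"
  shows "mean_deficit x < mean_deficit y"
  using assms mean_deficit_has_deriv mean_deficit_deriv_pos
  by (intro DERIV_pos_imp_increasing[OF assms(2)]) (meson less_le_trans)

lemma mean_deficit_le_iff:
  assumes "0 < x" "0 < y"
  shows "mean_deficit x \<le> mean_deficit y \<longleftrightarrow> x \<le> y"
  using mean_deficit_strict_mono[of x y] mean_deficit_strict_mono[of y x] assms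
  by (smt (verit))

lemma mean_deficit_tendsto_0: "(mean_deficit \<longlongrightarrow> 0) (at_right 0)"
  unfolding mean_deficit_def[abs_def] by real_asymp

lemma mean_deficit_tendsto_1: "(mean_deficit \<longlongrightarrow> 1) at_top"
  unfolding mean_deficit_def[abs_def] by real_asymp

lemma mean_deficit_over_x: "((\<lambda>x. mean_deficit x / x) \<longlongrightarrow> 2 / 3) (at_right 0)"
  unfolding mean_deficit_def[abs_def] by real_asymp

lemma mean_deficit_deriv_tendsto: "(mean_deficit_deriv \<longlongrightarrow> 2 / 3) (at_right 0)"
  unfolding mean_deficit_deriv_def[abs_def] by real_asymp

text \<open>Supplies a positive root of the moment equation when the sample mean lies strictly
  between 0 and 1; only a root gives information about the estimator.\<close>

lemma mean_deficit_surj: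
  assumes "0 < z" "z < 1"
  obtains x where "x > 0" "mean_deficit x = z"
proof -
  have "eventually (\<lambda>x. mean_deficit x < z \<and> x > 0) (at_right 0)"
    using order_tendstoD(2)[OF mean_deficit_tendsto_0 assms(1)] eventually_at_right_less
    by eventually_elim auto
  then obtain a where a: "mean_deficit a < z" "a > 0"
    by (metis (mono_tags, lifting) eventually_happens trivial_limit_at_right_real)
  have "eventually (\<lambda>x. mean_deficit x > z \<and> x > a) at_top"
    using order_tendstoD(1)[OF mean_deficit_tendsto_1 assms(2)] eventually_gt_at_top[of a]
    by eventually_elim auto
  then obtain b where b: "mean_deficit b > z" "b > a"
    by (metis (mono_tags, lifting) eventually_happens trivial_limit_at_top_linorder)
  have "\<exists>x\<ge>a. x \<le> b \<and> mean_deficit x = z"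
    using a b by (intro IVT) (auto intro!: DERIV_isCont mean_deficit_has_deriv)
  then obtain x where "x \<ge> a" "mean_deficit x = z" by blast
  then show ?thesis using a by (intro that[of x]) auto
qed

text \<open>Dividing by \<open>(v * D)\<^sup>2\<close> makes the equation dimensionless, so that the
  unknown enters only through \<open>l * D\<close>.\<close>

lemma moment_equation_iff:
  assumes "v > 0" "D > 0" "l > 0" "n \<ge> 1"
  shows "moment_equation v D n \<eta> l \<longleftrightarrow>
    1 - (\<Sum>i=1..n. (\<eta> i / (v * D))\<^sup>2) / real n = mean_deficit (l * D)"
proof -
  have "(\<Sum>i=1..n. (\<eta> i)\<^sup>2) = (v * D)\<^sup>2 * (\<Sum>i=1..n. (\<eta> i / (v * D))\<^sup>2)"
    using assms by (simp add: sum_distrib_left power_divide)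
  moreover define S where "S = (\<Sum>i=1..n. (\<eta> i / (v * D))\<^sup>2) / real n"
  ultimately have "1 / real n * (\<Sum>i=1..n. (\<eta> i)\<^sup>2) = (v * D)\<^sup>2 * S"
    by simp
  moreover have "v\<^sup>2 / l * (D - (1 - exp (- 2 * l * D)) / (2 * l)) = (v * D)\<^sup>2 * (1 - mean_deficit (l * D))"
    using assms by (simp add: mean_deficit_def field_simps power2_eq_square)
  ultimately show ?thesis
    using assms unfolding moment_equation_def S_def[symmetric]
    by (smt (verit) mult_cancel_left no_zero_divisors zero_eq_power2 mult_eq_0_iff)
qed

text \<open>By the mean value theorem the quotient equals \<open>x\<close> times the derivative at a
  point between the two arguments. Both arguments are positive and at most
  \<open>2 * lam * D n\<close>, so that point tends to 0 from the right, where the derivative tends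
  to \<open>2 / 3\<close>.\<close>

lemma mean_deficit_increment:
  assumes D: "D \<longlonglongrightarrow> 0" and Dpos: "eventually (\<lambda>n. D n > 0) sequentially"
    and r: "filterlim (\<lambda>n. r n) at_top sequentially" and "lam > 0"
  shows "(\<lambda>n. r n * (mean_deficit ((lam + x / r n) * D n) - mean_deficit (lam * D n)) / D n)
    \<longlonglongrightarrow> 2 / 3 * x"
proof -
  have rpos: "eventually (\<lambda>n. r n > 0) sequentially"
    using r by (simp add: filterlim_at_top_dense)
  have xr: "(\<lambda>n. x / r n) \<longlonglongrightarrow> 0"
    using r by (intro tendsto_divide_0[OF tendsto_const] filterlim_at_top_imp_at_infinity)
  then have "(\<lambda>n. lam + x / r n) \<longlonglongrightarrow> lam" using tendsto_add[OF tendsto_const xr, of lam] by simp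
  \<comment> \<open>The lower bound keeps the perturbed argument positive; the upper bound confines
    it to a multiple of \<open>D n\<close>.\<close>
  from order_tendstoD(1)[OF this, of "lam / 2"] order_tendstoD(2)[OF this, of "2 * lam"]
  have lb: "eventually (\<lambda>n. lam + x / r n > lam / 2) sequentially"
    and ub: "eventually (\<lambda>n. lam + x / r n < 2 * lam) sequentially"
    using \<open>lam > 0\<close> by simp_all
  have "\<exists>\<xi>. (0 < \<xi> \<and> \<xi> \<le> 2 * lam * D n) \<and>
      r n * (mean_deficit ((lam + x / r n) * D n) - mean_deficit (lam * D n)) / D n
      = mean_deficit_deriv \<xi> * x"
    if "lam + x / r n > lam / 2" "lam + x / r n < 2 * lam" "r n > 0" "D n > 0" for n
  proof -
    let ?a = "lam * D n" and ?b = "(lam + x / r n) * D n"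
    have pos: "?a > 0" "?b > 0" "?a \<le> 2 * lam * D n" "?b \<le> 2 * lam * D n"
    proof -
      have l: "lam + x / r n > 0" "lam + x / r n \<le> 2 * lam" using that(1,2) \<open>lam > 0\<close> by linarith+
      show "?a > 0" "?a \<le> 2 * lam * D n" using \<open>lam > 0\<close> that(4) by simp_all
      show "?b > 0" "?b \<le> 2 * lam * D n"
        using l that(4) by (auto intro!: mult_pos_pos mult_right_mono)
    qed
    have "\<exists>\<xi>. min ?a ?b \<le> \<xi> \<and> \<xi> \<le> max ?a ?b \<and> mean_deficit ?b - mean_deficit ?a = (?b - ?a) * mean_deficit_deriv \<xi>"
    \<comment> \<open>The sign of \<open>x\<close> is arbitrary, so either argument may be the
      larger one; if they coincide, both sides vanish.\<close>
    proof (cases ?a ?b rule: linorder_cases)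
      case less
      from MVT2[OF less, of mean_deficit mean_deficit_deriv] pos mean_deficit_has_deriv show ?thesis
        by (smt (verit))
    next
      case greater
      from MVT2[OF greater, of mean_deficit mean_deficit_deriv] pos mean_deficit_has_deriv obtain z
        where "?b < z" "z < ?a" "mean_deficit ?a - mean_deficit ?b = (?a - ?b) * mean_deficit_deriv z"
        by (smt (verit))
      then show ?thesis by (intro exI[of _ z]) (auto simp: algebra_simps)
    qed auto
    then obtain \<xi> where \<xi>: "min ?a ?b \<le> \<xi>" "\<xi> \<le> max ?a ?b"
      "mean_deficit ?b - mean_deficit ?a = (?b - ?a) * mean_deficit_deriv \<xi>" by blast
    have "?b - ?a = x / r n * D n" by (simp add: algebra_simps)
    then have "r n * (mean_deficit ?b - mean_deficit ?a) / D n = mean_deficit_deriv \<xi> * x"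
      using \<xi>(3) that by simp
    moreover have "0 < \<xi>" "\<xi> \<le> 2 * lam * D n" using \<xi> pos by linarith+
    ultimately show ?thesis by blast
  qed
  then obtain \<xi> where \<xi>: "\<And>n. lam + x / r n > lam / 2 \<Longrightarrow> lam + x / r n < 2 * lam \<Longrightarrow> r n > 0 \<Longrightarrow> D n > 0 \<Longrightarrow>
      0 < \<xi> n \<and> \<xi> n \<le> 2 * lam * D n \<and>
      r n * (mean_deficit ((lam + x / r n) * D n) - mean_deficit (lam * D n)) / D n
      = mean_deficit_deriv (\<xi> n) * x"
    by metis
  have ev: "eventually (\<lambda>n. 0 < \<xi> n \<and> \<xi> n \<le> 2 * lam * D n \<and>
      r n * (mean_deficit ((lam + x / r n) * D n) - mean_deficit (lam * D n)) / D n
      = mean_deficit_deriv (\<xi> n) * x) sequentially"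
    using lb ub rpos Dpos by eventually_elim (rule \<xi>)
  have "\<xi> \<longlonglongrightarrow> 0"
  proof (rule tendsto_sandwich[OF _ _ tendsto_const])
    show "eventually (\<lambda>n. \<xi> n \<le> 2 * lam * D n) sequentially" "eventually (\<lambda>n. 0 \<le> \<xi> n) sequentially"
      using ev by (auto elim: eventually_mono)
    show "(\<lambda>n. 2 * lam * D n) \<longlonglongrightarrow> 0" using D by (rule tendsto_mult_right_zero)
  qed
  then have "filterlim \<xi> (at_right 0) sequentially"
    using ev by (auto simp: filterlim_at elim: eventually_mono)
  from filterlim_compose[OF mean_deficit_deriv_tendsto this]
  have "(\<lambda>n. mean_deficit_deriv (\<xi> n) * x) \<longlonglongrightarrow> 2 / 3 * x" by (intro tendsto_intros)
  then show ?thesis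
    by (rule Lim_transform_eventually) (use ev in eventually_elim, simp)
qed

section \<open>Weak convergence and characteristic functions\<close>

text \<open>A fixed point slightly beside \<open>l\<close> eventually lies on the proper side of
  \<open>a n\<close>; monotonicity in the argument then transfers the pointwise limit to the moving
  one, and continuity at \<open>l\<close> makes the loss arbitrarily small.\<close>

lemma weak_conv_m_cdf_tendsto:
  assumes wc: "weak_conv_m \<mu> \<nu>" and \<mu>: "\<And>n. real_distribution (\<mu> n)"
    and cont: "\<And>x. isCont (cdf \<nu>) x" and a: "a \<longlonglongrightarrow> (l::real)"
  shows "(\<lambda>n. cdf (\<mu> n) (a n)) \<longlonglongrightarrow> cdf \<nu> l"
proof (rule order_tendstoI)
  have conv: "(\<lambda>n. cdf (\<mu> n) x) \<longlonglongrightarrow> cdf \<nu> x" for x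
    using wc cont by (auto simp: weak_conv_m_def weak_conv_def)
  have mono: "cdf (\<mu> n) x \<le> cdf (\<mu> n) y" if "x \<le> y" for n x y
  proof -
    interpret real_distribution "\<mu> n" by (rule \<mu>)
    show ?thesis using that by (rule cdf_nondecreasing)
  qed
  have lim: "(cdf \<nu> \<longlongrightarrow> cdf \<nu> l) (at_left l)" "(cdf \<nu> \<longlongrightarrow> cdf \<nu> l) (at_right l)"
    using cont[of l] by (auto simp: isCont_def intro: tendsto_within_subset)
  fix y
  {
    assume "y < cdf \<nu> l"
    then have "eventually (\<lambda>x. y < cdf \<nu> x \<and> x < l) (at_left l)"
      by (intro eventually_conj order_tendstoD(1)[OF lim(1)]) (auto simp: eventually_at_filter)
    then obtain x where x: "y < cdf \<nu> x" "x < l"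
      using eventually_happens trivial_limit_at_left_real by blast
    have "eventually (\<lambda>n. y < cdf (\<mu> n) x) sequentially" by (rule order_tendstoD(1)[OF conv x(1)])
    moreover have "eventually (\<lambda>n. x < a n) sequentially" by (rule order_tendstoD(1)[OF a x(2)])
    ultimately show "eventually (\<lambda>n. y < cdf (\<mu> n) (a n)) sequentially"
      by eventually_elim (use mono in \<open>meson less_le_trans less_imp_le\<close>)
  }
  {
    assume "cdf \<nu> l < y"
    then have "eventually (\<lambda>x. cdf \<nu> x < y \<and> l < x) (at_right l)"
      by (intro eventually_conj order_tendstoD(2)[OF lim(2)] eventually_at_right_less)
    then obtain x where x: "cdf \<nu> x < y" "l < x"
      using eventually_happens trivial_limit_at_right_real by blast
    have "eventually (\<lambda>n. cdf (\<mu> n) x < y) sequentially" by (rule order_tendstoD(2)[OF conv x(1)])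
    moreover have "eventually (\<lambda>n. a n < x) sequentially" by (rule order_tendstoD(2)[OF a x(2)])
    ultimately show "eventually (\<lambda>n. cdf (\<mu> n) (a n) < y) sequentially"
      by eventually_elim (use mono in \<open>meson le_less_trans less_imp_le\<close>)
  }
qed

text \<open>A point where the limiting distribution function is below \<open>y\<close> eventually
  lies above \<open>a n\<close>, so monotonicity passes the bound on. The next lemma is the mirror
  image.\<close>

lemma weak_conv_m_cdf_at_bot:
  assumes wc: "weak_conv_m \<mu> \<nu>" and \<mu>: "\<And>n. real_distribution (\<mu> n)" and \<nu>: "real_distribution \<nu>"
    and cont: "\<And>x. isCont (cdf \<nu>) x" and a: "filterlim a at_bot sequentially"
  shows "(\<lambda>n. cdf (\<mu> n) (a n)) \<longlonglongrightarrow> 0"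
proof (rule order_tendstoI)
  have conv: "(\<lambda>n. cdf (\<mu> n) x) \<longlonglongrightarrow> cdf \<nu> x" for x
    using wc cont by (auto simp: weak_conv_m_def weak_conv_def)
  have mono: "cdf (\<mu> n) x \<le> cdf (\<mu> n) y" if "x \<le> y" for n x y
  proof -
    interpret real_distribution "\<mu> n" by (rule \<mu>)
    show ?thesis using that by (rule cdf_nondecreasing)
  qed
  interpret \<nu>: real_distribution \<nu> by (rule \<nu>)
  fix y :: real
  { assume "y < 0"
    then show "eventually (\<lambda>n. y < cdf (\<mu> n) (a n)) sequentially"
      by (intro always_eventually allI) (simp add: less_le_trans[OF _ measure_nonneg] cdf_def) }
  assume "0 < y"
  then have "eventually (\<lambda>x. cdf \<nu> x < y) at_bot" by (intro order_tendstoD(2)[OF \<nu>.cdf_lim_at_bot])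
  then obtain x where x: "cdf \<nu> x < y" using eventually_happens trivial_limit_at_bot_linorder by blast
  have "eventually (\<lambda>n. cdf (\<mu> n) x < y) sequentially" by (rule order_tendstoD(2)[OF conv x])
  moreover have "eventually (\<lambda>n. a n \<le> x) sequentially" using a by (simp add: filterlim_at_bot)
  ultimately show "eventually (\<lambda>n. cdf (\<mu> n) (a n) < y) sequentially"
    by eventually_elim (use mono in \<open>meson le_less_trans less_imp_le\<close>)
qed

lemma weak_conv_m_cdf_at_top:
  assumes wc: "weak_conv_m \<mu> \<nu>" and \<mu>: "\<And>n. real_distribution (\<mu> n)" and \<nu>: "real_distribution \<nu>"
    and cont: "\<And>x. isCont (cdf \<nu>) x" and a: "filterlim a at_top sequentially"
  shows "(\<lambda>n. cdf (\<mu> n) (a n)) \<longlonglongrightarrow> 1"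
proof (rule order_tendstoI)
  have conv: "(\<lambda>n. cdf (\<mu> n) x) \<longlonglongrightarrow> cdf \<nu> x" for x
    using wc cont by (auto simp: weak_conv_m_def weak_conv_def)
  have mono: "cdf (\<mu> n) x \<le> cdf (\<mu> n) y" if "x \<le> y" for n x y
  proof -
    interpret real_distribution "\<mu> n" by (rule \<mu>)
    show ?thesis using that by (rule cdf_nondecreasing)
  qed
  interpret \<nu>: real_distribution \<nu> by (rule \<nu>)
  fix y :: real
  { assume "1 < y"
    then show "eventually (\<lambda>n. cdf (\<mu> n) (a n) < y) sequentially"
      by (intro always_eventually allI) (rule le_less_trans[OF real_distribution.cdf_bounded_prob[OF \<mu>]]) }
  assume "y < 1"
  then have "eventually (\<lambda>x. y < cdf \<nu> x) at_top" by (intro order_tendstoD(1)[OF \<nu>.cdf_lim_at_top_prob])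
  then obtain x where x: "y < cdf \<nu> x" using eventually_happens trivial_limit_at_top_linorder by blast
  have "eventually (\<lambda>n. y < cdf (\<mu> n) x) sequentially" by (rule order_tendstoD(1)[OF conv x])
  moreover have "eventually (\<lambda>n. x \<le> a n) sequentially" using a by (simp add: filterlim_at_top)
  ultimately show "eventually (\<lambda>n. y < cdf (\<mu> n) (a n)) sequentially"
    by eventually_elim (use mono in \<open>meson less_le_trans less_imp_le\<close>)
qed

section \<open>The normal distribution function\<close>

lemma real_distribution_normal:
  assumes "s > 0"
  shows "real_distribution (density lborel (normal_density m s))"
  using prob_space_normal_density[OF assms, of m] by (simp add: real_distribution_def real_distribution_axioms_def)

lemma isCont_cdf_normal:
  assumes "s > 0"
  shows "isCont (cdf (density lborel (normal_density m s))) x"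
proof -
  interpret real_distribution "density lborel (normal_density m s)"
    by (rule real_distribution_normal[OF assms])
  have "AE y in lborel. y \<noteq> x" by (rule AE_lborel_singleton)
  then have "emeasure (density lborel (normal_density m s)) {x} = 0"
    by (subst emeasure_density) (auto simp: nn_integral_0_iff_AE indicator_def elim: eventually_mono)
  then show ?thesis unfolding isCont_cdf by (simp add: measure_def)
qed

lemma cdf_normal_eq_std:
  assumes "s > 0"
  shows "cdf (density lborel (normal_density 0 s)) x = cdf std_normal_distribution (x / s)"
proof -
  interpret real_distribution "density lborel (normal_density 0 s)"
    by (rule real_distribution_normal[OF assms])
  have "distributed (density lborel (normal_density 0 s)) lborel (\<lambda>x. x) (normal_density 0 s)"
    by (auto simp: distributed_def intro!: measure_eqI simp: emeasure_distr)
  then have "distributed (density lborel (normal_density 0 s)) lborel (\<lambda>x. x / s) std_normal_density"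
    using normal_standard_normal_convert[OF assms, of "\<lambda>x. x" 0] by simp
  then have "std_normal_distribution = distr (density lborel (normal_density 0 s)) lborel (\<lambda>x. x / s)"
    by (simp add: distributed_def)
  then have "cdf std_normal_distribution (x / s) = measure (distr (density lborel (normal_density 0 s)) lborel (\<lambda>x. x / s)) {..x / s}"
    by (simp add: cdf_def)
  also have "\<dots> = cdf (density lborel (normal_density 0 s)) x"
    using assms by (subst measure_distr) (auto simp: cdf_def divide_le_cancel intro!: arg_cong2[where f = measure])
  finally show ?thesis ..
qed

section \<open>A central limit theorem for bounded summands whose law varies with the row\<close>

lemma exp_minus_linear_bound:
  fixes y :: real assumes "y \<ge> 0"
  shows "\<bar>exp (-y) - (1 - y)\<bar> \<le> y\<^sup>2"
proof -
  have lo: "1 - y \<le> exp (-y)" using exp_ge_add_one_self[of "-y"] by simp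
  have "1 + y \<le> exp y" by (rule exp_ge_add_one_self)
  then have "exp (-y) \<le> 1 / (1 + y)" using assms by (simp add: exp_minus field_simps)
  \<comment> \<open>Clearing the denominator,
    \<open>(1 + y) * (1 - y + y\<^sup>2) = 1 + y ^ 3\<close>.\<close>
  also have "\<dots> \<le> 1 - y + y\<^sup>2"
    using assms by (simp add: field_simps power2_eq_square) 
  finally show ?thesis using lo by simp
qed

text \<open>The bound \<open>\<bar>W\<bar> \<le> 1\<close> gives
  \<open>\<bar>W\<bar> ^ 3 \<le> W\<^sup>2\<close>, so the third-order remainder is controlled by
  the variance alone, even when the variance shrinks.\<close>

lemma (in prob_space) char_centred_bounded_approx:
  assumes [measurable]: "random_variable borel W"
    and bd: "\<And>\<omega>. \<omega> \<in> space M \<Longrightarrow> \<bar>W \<omega>\<bar> \<le> 1" and mean: "expectation W = 0"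
  shows "cmod (char (distr M borel W) u - (1 - u\<^sup>2 * expectation (\<lambda>\<omega>. (W \<omega>)\<^sup>2) / 2))
    \<le> \<bar>u\<bar> ^ 3 / 6 * expectation (\<lambda>\<omega>. (W \<omega>)\<^sup>2)"
proof -
  have int: "integrable M W" "integrable M (\<lambda>\<omega>. (W \<omega>)\<^sup>2)"
    using bd by (auto intro!: integrable_const_bound[where B=1] simp: abs_square_le_1)
  have "cmod (char (distr M borel W) u - (1 - u\<^sup>2 * expectation (\<lambda>\<omega>. (W \<omega>)\<^sup>2) / 2))
    \<le> (u\<^sup>2 / 6) * expectation (\<lambda>\<omega>. min (6 * (W \<omega>)\<^sup>2) (\<bar>u\<bar> * \<bar>W \<omega>\<bar> ^ 3))"
    using mean int by (intro char_approx3') auto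
  also have "\<dots> \<le> (u\<^sup>2 / 6) * expectation (\<lambda>\<omega>. \<bar>u\<bar> * (W \<omega>)\<^sup>2)"
  proof (intro mult_left_mono integral_mono)
    fix \<omega> assume "\<omega> \<in> space M"
    then have "\<bar>W \<omega>\<bar> ^ 3 \<le> \<bar>W \<omega>\<bar> ^ 2" using bd by (intro power_decreasing) auto
    then show "min (6 * (W \<omega>)\<^sup>2) (\<bar>u\<bar> * \<bar>W \<omega>\<bar> ^ 3) \<le> \<bar>u\<bar> * (W \<omega>)\<^sup>2"
      by (auto intro!: min.coboundedI2 mult_left_mono)
  next
    show "integrable M (\<lambda>\<omega>. min (6 * (W \<omega>)\<^sup>2) (\<bar>u\<bar> * \<bar>W \<omega>\<bar> ^ 3))"
      by (rule Bochner_Integration.integrable_bound[of M "\<lambda>\<omega>. 6 * (W \<omega>)\<^sup>2"]) (use int in auto)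
  qed (use int in auto)
  also have "\<dots> = \<bar>u\<bar> ^ 3 / 6 * expectation (\<lambda>\<omega>. (W \<omega>)\<^sup>2)"
    by (simp add: power3_eq_cube power2_eq_square flip: abs_mult)
  finally show ?thesis .
qed

text \<open>The normalisation uses \<open>d n\<close>, which only has to be asymptotically equal to
  the variance of one summand. The growth of \<open>n * d n\<close> acts as the Lyapunov condition:
  it removes the third-order term.\<close>

lemma (in prob_space) char_power_tendsto_normal:
  fixes W :: "nat \<Rightarrow> 'a \<Rightarrow> real" and d :: "nat \<Rightarrow> real"
  assumes W: "\<And>n. random_variable borel (W n)"
    and bd: "\<And>n \<omega>. \<omega> \<in> space M \<Longrightarrow> \<bar>W n \<omega>\<bar> \<le> 1" and mean: "\<And>n. expectation (W n) = 0"
    and var: "(\<lambda>n. expectation (\<lambda>\<omega>. (W n \<omega>)\<^sup>2) / d n) \<longlonglongrightarrow> 1"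
    and nd: "filterlim (\<lambda>n. real n * d n) at_top sequentially"
  shows "(\<lambda>n. (char (distr M borel (W n)) (t / sqrt (real n * d n))) ^ n)
    \<longlonglongrightarrow> char std_normal_distribution t"
proof -
  define s where "s n = expectation (\<lambda>\<omega>. (W n \<omega>)\<^sup>2)" for n
  \<comment> \<open>In order: the third-order remainder, the gap between the true and the
    normalising variance, and the linearisation of \<open>exp\<close>, each being the error of one
    factor times \<open>n\<close>.\<close>
  define e where "e n = \<bar>t\<bar> ^ 3 / 6 * (s n / d n) / sqrt (real n * d n) + t\<^sup>2 / 2 * \<bar>s n / d n - 1\<bar>
    + (t\<^sup>2 / 2)\<^sup>2 / real n" for n
  have bound: "eventually (\<lambda>n. cmod ((char (distr M borel (W n)) (t / sqrt (real n * d n))) ^ n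
      - char std_normal_distribution t) \<le> e n) sequentially"
    using eventually_gt_at_top[of 0] nd[unfolded filterlim_at_top_dense, rule_format, of 0]
  proof eventually_elim
    case (elim n)
    then have n: "real n > 0" "d n > 0" by (auto simp: zero_less_mult_iff)
    define u where "u = t / sqrt (real n * d n)"
    define y where "y = t\<^sup>2 / 2 / real n"
    have u2: "u\<^sup>2 = t\<^sup>2 / (real n * d n)" using n by (simp add: u_def power_divide)
    have "y \<ge> 0" by (simp add: y_def)
    interpret Wn: real_distribution "distr M borel (W n)" using W by (rule real_distribution_distr)
    \<comment> \<open>Once the limit is an \<open>n\<close>-th power as well, the difference of the
      powers is at most \<open>n\<close> times the difference of the bases, since both bases have
      modulus at most 1.\<close>
    have "char std_normal_distribution t = complex_of_real (exp (-y)) ^ n"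
      using n by (simp add: char_std_normal_distribution y_def flip: exp_of_nat_mult of_real_power)
    then have "cmod ((char (distr M borel (W n)) u) ^ n - char std_normal_distribution t)
      \<le> real n * cmod (char (distr M borel (W n)) u - complex_of_real (exp (-y)))"
      using \<open>y \<ge> 0\<close> by (auto intro!: norm_power_diff Wn.cmod_char_le_1)
    also have "cmod (char (distr M borel (W n)) u - complex_of_real (exp (-y))) \<le>
      cmod (char (distr M borel (W n)) u - (1 - u\<^sup>2 * s n / 2)) + cmod ((1 - u\<^sup>2 * s n / 2) - complex_of_real (exp (-y)))"
      by norm
    also have "cmod (char (distr M borel (W n)) u - (1 - u\<^sup>2 * s n / 2)) \<le> \<bar>u\<bar> ^ 3 / 6 * s n"
      using char_centred_bounded_approx[OF W bd mean, of n u] by (simp add: s_def)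
    also have "cmod ((1 - u\<^sup>2 * s n / 2) - complex_of_real (exp (-y))) = \<bar>(1 - u\<^sup>2 * s n / 2) - exp (-y)\<bar>"
      by (simp only: of_real_diff[symmetric] norm_of_real)
    also have "\<dots> \<le> \<bar>u\<^sup>2 * s n / 2 - y\<bar> + \<bar>exp (-y) - (1 - y)\<bar>" by linarith
    also have "\<bar>exp (-y) - (1 - y)\<bar> \<le> y\<^sup>2" by (rule exp_minus_linear_bound[OF \<open>y \<ge> 0\<close>])
    also have "real n * (\<bar>u\<bar> ^ 3 / 6 * s n + (\<bar>u\<^sup>2 * s n / 2 - y\<bar> + y\<^sup>2)) = e n"
    proof -
      have "u\<^sup>2 * s n / 2 - y = (t\<^sup>2 / 2 / real n) * (s n / d n - 1)"
        using n by (simp add: u2 y_def field_simps)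
      then have 1: "real n * \<bar>u\<^sup>2 * s n / 2 - y\<bar> = t\<^sup>2 / 2 * \<bar>s n / d n - 1\<bar>"
        using n by (simp add: abs_mult)
      have 2: "real n * y\<^sup>2 = (t\<^sup>2 / 2)\<^sup>2 / real n"
        using n by (simp add: y_def power2_eq_square)
      have "\<bar>u\<bar> ^ 3 = u\<^sup>2 * \<bar>u\<bar>" by (simp add: power3_eq_cube power2_eq_square)
      also have "\<dots> = \<bar>t\<bar> ^ 3 / (real n * d n) / sqrt (real n * d n)"
        using n by (simp add: u2) (simp add: u_def power3_eq_cube power2_eq_square)
      finally have 3: "real n * (\<bar>u\<bar> ^ 3 / 6 * s n) = \<bar>t\<bar> ^ 3 / 6 * (s n / d n) / sqrt (real n * d n)"
        using n by simp
      show ?thesis unfolding distrib_left 1 2 3 e_def by simp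
    qed
    finally show ?case using n by (simp add: u_def)
  qed
  have "e \<longlonglongrightarrow> \<bar>t\<bar> ^ 3 / 6 * 1 * 0 + t\<^sup>2 / 2 * \<bar>1 - 1\<bar> + 0"
  proof -
    have "(\<lambda>n. 1 / sqrt (real n * d n)) \<longlonglongrightarrow> 0"
      by (intro tendsto_divide_0[OF tendsto_const] filterlim_at_top_imp_at_infinity
          filterlim_compose[OF sqrt_at_top] nd)
    then have "(\<lambda>n. \<bar>t\<bar> ^ 3 / 6 * (s n / d n) * (1 / sqrt (real n * d n)) + t\<^sup>2 / 2 * \<bar>s n / d n - 1\<bar>
      + (t\<^sup>2 / 2)\<^sup>2 / real n) \<longlonglongrightarrow> \<bar>t\<bar> ^ 3 / 6 * 1 * 0 + t\<^sup>2 / 2 * \<bar>1 - 1\<bar> + 0"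
      using var unfolding s_def[symmetric] by (intro tendsto_intros lim_const_over_n)
    then show ?thesis by (simp add: e_def[abs_def])
  qed
  then have "e \<longlonglongrightarrow> 0" by simp
  with bound show ?thesis
    by (rule LIM_zero_cancel[OF Lim_null_comparison])
qed

section \<open>Integrals of the velocity path\<close>

lemma (in prob_space) char_distr_tendsto:
  assumes X: "\<And>k. X k \<in> borel_measurable M"
    and lim: "\<And>\<omega>. \<omega> \<in> space M \<Longrightarrow> (\<lambda>k. X k \<omega>) \<longlonglongrightarrow> Y \<omega>"
  shows "(\<lambda>k. char (distr M borel (X k)) t) \<longlonglongrightarrow> char (distr M borel Y) t"
proof -
  have [measurable]: "X k \<in> borel_measurable M" for k by (rule X)
  have [measurable]: "Y \<in> borel_measurable M"
    by (rule borel_measurable_LIMSEQ_real[OF lim X])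
  have "(\<lambda>k. CLINT \<omega>|M. iexp (t * X k \<omega>)) \<longlonglongrightarrow> (CLINT \<omega>|M. iexp (t * Y \<omega>))"
    by (rule integral_dominated_convergence[where w = "\<lambda>_. 1"])
       (auto intro!: tendsto_intros lim AE_I2)
  then show ?thesis by (simp add: char_def integral_distr)
qed

text \<open>For the increments \<open>x\<close> of \<open>N\<close> on a grid of \<open>m\<close> cells this is \<open>deficit\<close> below with the
  integral replaced by a left Riemann sum, up to the sign \<open>(-1) ^ N a\<close>, which the square removes.\<close>

definition grid_deficit :: "nat \<Rightarrow> (nat \<Rightarrow> nat) \<Rightarrow> real" where
  "grid_deficit m x = 1 - ((\<Sum>j<m. (-1) ^ (\<Sum>l<j. x l)) / real m)\<^sup>2"

text \<open>The sign \<open>(-1) ^ k\<close> is replaced by \<open>cos (pi * k)\<close>, a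
  continuous function of a real argument, so measurability follows from that of the partial sums.
  Asking it only of the coordinates below \<open>m\<close> makes the lemma applicable to finite
  products.\<close>

lemma grid_deficit_measurable [measurable]:
  assumes [measurable]: "\<And>j. j < m \<Longrightarrow> (\<lambda>\<omega>. f \<omega> j) \<in> measurable P (count_space UNIV)"
  shows "(\<lambda>\<omega>. grid_deficit m (f \<omega>)) \<in> borel_measurable P"
proof -
  have "(\<lambda>\<omega>. \<Sum>l<j. real (f \<omega> l)) \<in> borel_measurable P" if "j < m" for j
  proof (intro borel_measurable_sum)
    fix l assume "l \<in> {..<j}"
    then show "(\<lambda>\<omega>. real (f \<omega> l)) \<in> borel_measurable P"
      using that by (intro measurable_compose[OF assms]) auto
  qed
  then have [measurable]: "(\<lambda>\<omega>. cos (pi * real (\<Sum>l<j. f \<omega> l))) \<in> borel_measurable P" if "j < m" for j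
    using that by simp
  have "(\<lambda>\<omega>. \<Sum>j<m. cos (pi * real (\<Sum>l<j. f \<omega> l))) \<in> borel_measurable P"
    by (intro borel_measurable_sum) (simp del: of_nat_sum cos_npi)
  then show ?thesis unfolding grid_deficit_def by (simp del: of_nat_sum)
qed

section \<open>Joint measurability of \<open>N\<close>, Riemann sums, and independence of the
  blocks\<close>

context poisson_process
begin

lemma borel_measurable_N:
  assumes "0 \<le> t"
  shows "(\<lambda>\<omega>. real (N t \<omega>)) \<in> borel_measurable M"
  using N_measurable[OF assms] by measurable

text \<open>With \<open>max 0 s\<close> the path is frozen at negative times, where \<open>N\<close>
  is unconstrained; the result is nondecreasing on the whole line, hence Borel.\<close>

lemma borel_measurable_N_path:
  assumes "\<omega> \<in> space M"
  shows "(\<lambda>s. real (N (max 0 s) \<omega>)) \<in> borel_measurable borel"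
  by (intro borel_measurable_mono monoI) (simp add: N_mono[OF assms])

lemma N_tendsto_right:
  assumes "\<omega> \<in> space M" "0 \<le> t" "\<And>k. t < u k" "u \<longlonglongrightarrow> t"
  shows "(\<lambda>k. real (N (u k) \<omega>)) \<longlonglongrightarrow> real (N t \<omega>)"
proof -
  have "filterlim u (at_right t) sequentially"
    using assms by (auto simp: filterlim_at eventually_sequentially)
  moreover have "((\<lambda>s. N s \<omega>) \<longlongrightarrow> N t \<omega>) (at_right t)"
    using N_right_continuous[OF assms(1,2)] by (simp add: continuous_within)
  ultimately have "(\<lambda>k. N (u k) \<omega>) \<longlonglongrightarrow> N t \<omega>" by (rule filterlim_compose[rotated])
  then show ?thesis unfolding tendsto_discrete by (intro tendsto_eventually) (auto elim: eventually_mono)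
qed

text \<open>Needed for Fubini. Time is rounded to a grid of mesh \<open>1 / (k + 1)\<close>; for
  fixed \<open>k\<close> only countably many times occur, each giving a measurable variable, and
  right continuity yields the limit.\<close>

lemma N_pair_measurable [measurable]:
  "(\<lambda>p. real (N (max 0 (fst p)) (snd p))) \<in> borel_measurable (lborel \<Otimes>\<^sub>M M)"
proof -
  \<comment> \<open>The \<open>+ 1\<close> after the floor moves the grid point strictly to the
    right of \<open>max 0 s\<close>, the side on which the paths are continuous.\<close>
  define u where "u = (\<lambda>(k::nat) (s::real). (real (nat \<lfloor>max 0 s * (real k + 1)\<rfloor>) + 1) / (real k + 1))"
  have u: "max 0 s < u k s" "u k s \<le> max 0 s + 1 / (real k + 1)" for k s
  proof -
    define y f where "y = max 0 s * (real k + 1)" and "f = real (nat \<lfloor>y\<rfloor>)"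
    have "y \<ge> 0" by (simp add: y_def)
    then have f: "y < f + 1" "f \<le> y" unfolding f_def by linarith+
    have "max 0 s = y / (real k + 1)" "u k s = (f + 1) / (real k + 1)"
      by (simp_all add: u_def y_def f_def add.commute)
    then show "max 0 s < u k s" "u k s \<le> max 0 s + 1 / (real k + 1)"
      using f by (simp_all add: divide_strict_right_mono divide_right_mono add.commute flip: add_divide_distrib)
  qed
  show ?thesis
  proof (rule borel_measurable_LIMSEQ_real[where u = "\<lambda>k p. real (N (u k (fst p)) (snd p))"])
    fix p :: "real \<times> 'a" assume p: "p \<in> space (lborel \<Otimes>\<^sub>M M)"
    have "(\<lambda>k. u k (fst p)) \<longlonglongrightarrow> max 0 (fst p)"
    proof (rule tendsto_sandwich[OF _ _ tendsto_const])
      have "(\<lambda>k. max 0 (fst p) + 1 / (real k + 1)) \<longlonglongrightarrow> max 0 (fst p) + 0"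
        using LIMSEQ_inverse_real_of_nat by (intro tendsto_intros) (simp add: inverse_eq_divide add.commute)
      then show "(\<lambda>k. max 0 (fst p) + 1 / (real k + 1)) \<longlonglongrightarrow> max 0 (fst p)" by simp
    qed (use u in \<open>auto simp: less_imp_le\<close>)
    then show "(\<lambda>k. real (N (u k (fst p)) (snd p))) \<longlonglongrightarrow> real (N (max 0 (fst p)) (snd p))"
      using p u by (intro N_tendsto_right) (auto simp: space_pair_measure)
  next
    fix k :: nat
    have "(\<lambda>p. real (N ((real i + 1) / (real k + 1)) (snd p))) \<in> borel_measurable (lborel \<Otimes>\<^sub>M M)" for i
      by (rule measurable_compose[OF measurable_snd borel_measurable_N[of "(real i + 1) / (real k + 1)"]]) simp
    then show "(\<lambda>p. real (N (u k (fst p)) (snd p))) \<in> borel_measurable (lborel \<Otimes>\<^sub>M M)"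
      unfolding u_def
      by (rule measurable_compose_countable'[where I = UNIV]) auto
  qed
qed

lemma path_integrable:
  assumes "\<omega> \<in> space M" "0 \<le> a"
  shows "set_integrable lborel {a..b} (\<lambda>s. (-1) ^ N s \<omega> :: real)"
proof -
  have [measurable]: "(\<lambda>s. real (N (max 0 s) \<omega>)) \<in> borel_measurable borel"
    by (rule borel_measurable_N_path[OF assms(1)])
  have [measurable]: "(\<lambda>s. cos (pi * real (N (max 0 s) \<omega>))) \<in> borel_measurable borel"
    by measurable
  have "integrable lborel (\<lambda>s. indicator {a..b} s *\<^sub>R cos (pi * real (N (max 0 s) \<omega>)))"
    by (rule Bochner_Integration.integrable_bound[of _ "indicator {a..b} :: real \<Rightarrow> real"])
       (auto simp: emeasure_lborel_Icc_eq simp del: cos_npi cos_npi2 split: split_indicator)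
  also have "(\<lambda>s. indicator {a..b} s *\<^sub>R cos (pi * real (N (max 0 s) \<omega>)))
      = (\<lambda>s. indicator {a..b} s *\<^sub>R ((-1) ^ N s \<omega>))"
    using assms by (auto simp: fun_eq_iff indicator_def)
  finally show ?thesis by (simp add: set_integrable_def)
qed

lemma path_integral_bound:
  assumes "\<omega> \<in> space M" "0 \<le> a" "a \<le> b"
  shows "\<bar>LBINT s:{a..b}. (-1) ^ N s \<omega>\<bar> \<le> b - a"
proof -
  have "norm (LBINT s:{a..b}. (-1) ^ N s \<omega> :: real) \<le> (LBINT s:{a..b}. 1)"
    unfolding set_lebesgue_integral_def
    by (rule Bochner_Integration.integral_norm_bound_integral)
       (use path_integrable[OF assms(1,2)] in
         \<open>auto simp: set_integrable_def emeasure_lborel_Icc_eq split: split_indicator\<close>)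
  also have "\<dots> = b - a" using assms by (simp add: set_lebesgue_integral_def)
  finally show ?thesis by simp
qed

lemma path_integral_combine:
  assumes "\<omega> \<in> space M" "0 \<le> a" "a \<le> b" "b \<le> c"
  shows "(LBINT s:{a..c}. (-1) ^ N s \<omega> :: real) = (LBINT s:{a..b}. (-1) ^ N s \<omega>) + (LBINT s:{b..c}. (-1) ^ N s \<omega>)"
proof -
  have int: "set_integrable lborel {x..y} (\<lambda>s. (-1) ^ N s \<omega> :: real)" if "0 \<le> x" for x y
    using path_integrable[OF assms(1) that] .
  have eq: "(LBINT s:{x..y}. (-1) ^ N s \<omega> :: real) = integral {x..y} (\<lambda>s. (-1) ^ N s \<omega>)" if "0 \<le> x" for x y
    by (rule set_borel_integral_eq_integral(2)[OF int[OF that]])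
  have "(\<lambda>s. (-1) ^ N s \<omega> :: real) integrable_on {a..c}"
    by (rule set_borel_integral_eq_integral(1)[OF int]) (use assms in auto)
  then show ?thesis
    using assms by (simp add: eq Henstock_Kurzweil_Integration.integral_combine)
qed

lemma path_integral_shift:
  assumes "\<omega> \<in> space M" "0 \<le> a" "a \<le> b"
  shows "(LBINT s:{0..b}. (-1) ^ N s \<omega> :: real) - (LBINT s:{0..a}. (-1) ^ N s \<omega>) = (LBINT s:{a..b}. (-1) ^ N s \<omega>)"
  using path_integral_combine[OF assms(1) order_refl assms(2,3)] by simp

text \<open>Without a jump in the cell the integrand is constant and the error is 0. With at least
  one jump, both terms are at most \<open>h\<close> in absolute value, which gives the factor
  2.\<close>

lemma path_integral_cell:
  assumes \<omega>: "\<omega> \<in> space M" and "0 \<le> c" "0 \<le> h"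
  shows "\<bar>(LBINT s:{c..c+h}. (-1) ^ N s \<omega>) - h * (-1) ^ N c \<omega>\<bar>
    \<le> 2 * h * (real (N (c + h) \<omega>) - real (N c \<omega>))"
proof (cases "N (c + h) \<omega> = N c \<omega>")
  case True
  have "(-1) ^ N s \<omega> = ((-1) ^ N c \<omega> :: real)" if "s \<in> {c..c+h}" for s
    using that N_mono[OF \<omega>, of c s] N_mono[OF \<omega>, of s "c + h"] assms True by auto
  then have "(LBINT s:{c..c+h}. (-1) ^ N s \<omega> :: real) = (LBINT s:{c..c+h}. (-1) ^ N c \<omega>)"
    by (intro set_lebesgue_integral_cong allI impI) simp
  also have "\<dots> = h * (-1) ^ N c \<omega>"
    using assms by (simp add: set_lebesgue_integral_def)
  finally show ?thesis by (simp add: True)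
next
  case False
  then have "real (N (c + h) \<omega>) - real (N c \<omega>) \<ge> 1"
    using N_mono[OF \<omega>, of c "c + h"] assms by auto
  then have "2 * h * 1 \<le> 2 * h * (real (N (c + h) \<omega>) - real (N c \<omega>))"
    using assms by (intro mult_left_mono) auto
  moreover have "\<bar>LBINT s:{c..c+h}. (-1) ^ N s \<omega>\<bar> \<le> h"
    using path_integral_bound[OF \<omega>, of c "c + h"] assms by simp
  moreover have "\<bar>h * (-1) ^ N c \<omega>\<bar> = h" using assms by (simp add: abs_mult power_abs)
  ultimately show ?thesis by linarith
qed

text \<open>A cell contributes an error only if \<open>N\<close> jumps in it, so the errors telescope.\<close>

lemma path_riemann_sum:
  assumes \<omega>: "\<omega> \<in> space M" and "0 \<le> a" "0 \<le> h"
  shows "\<bar>(LBINT s:{a..a + real m * h}. (-1) ^ N s \<omega>) - h * (\<Sum>j<m. (-1) ^ N (a + real j * h) \<omega>)\<bar>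
    \<le> 2 * h * (real (N (a + real m * h) \<omega>) - real (N a \<omega>))"
proof (induction m)
  case 0
  show ?case using path_integral_bound[OF \<omega>, of a a] assms by simp
next
  case (Suc m)
  define c where "c = a + real m * h"
  have c: "0 \<le> c" "a \<le> c" using assms by (auto simp: c_def)
  have eq: "a + real (Suc m) * h = c + h" by (simp add: c_def algebra_simps)
  have "(LBINT s:{a..c + h}. (-1) ^ N s \<omega> :: real) = (LBINT s:{a..c}. (-1) ^ N s \<omega>) + (LBINT s:{c..c + h}. (-1) ^ N s \<omega>)"
    using c assms by (intro path_integral_combine) auto
  moreover have "h * (\<Sum>j<Suc m. (-1) ^ N (a + real j * h) \<omega>)
      = h * (\<Sum>j<m. (-1) ^ N (a + real j * h) \<omega>) + h * (-1) ^ N c \<omega>"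
    by (simp add: c_def distrib_left)
  moreover have "2 * h * (real (N (c + h) \<omega>) - real (N a \<omega>))
      = 2 * h * (real (N (c + h) \<omega>) - real (N c \<omega>)) + 2 * h * (real (N c \<omega>) - real (N a \<omega>))"
    by (simp add: algebra_simps)
  ultimately show ?case
    using Suc path_integral_cell[OF \<omega> c(1) assms(3)] unfolding eq c_def[symmetric] by linarith
qed

text \<open>For \<open>a = (i - 1) * D\<close> and \<open>(V0 \<omega>)\<^sup>2 = v\<^sup>2\<close>
  this is \<open>Z_i\<close>, written through \<open>N\<close> alone. The integrand keeps the sign
  counted from time 0 instead of time \<open>a\<close>; the two differ by a constant factor whose
  square is 1.\<close>

definition deficit :: "real \<Rightarrow> real \<Rightarrow> 'a \<Rightarrow> real" where
  "deficit D a \<omega> = 1 - ((LBINT s:{a..a + D}. (-1) ^ N s \<omega>) / D)\<^sup>2"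

definition block_increment :: "real \<Rightarrow> real \<Rightarrow> nat \<Rightarrow> nat \<Rightarrow> 'a \<Rightarrow> nat" where
  "block_increment D a m j \<omega> = N (a + real (Suc j) * (D / real m)) \<omega> - N (a + real j * (D / real m)) \<omega>"

lemma deficit_bounds:
  assumes "\<omega> \<in> space M" "0 \<le> a" "0 < D"
  shows "0 \<le> deficit D a \<omega>" "deficit D a \<omega> \<le> 1"
proof -
  have "\<bar>(LBINT s:{a..a + D}. (-1) ^ N s \<omega>) / D\<bar> \<le> 1"
    using path_integral_bound[OF assms(1,2), of "a + D"] assms(3) by (simp add: divide_le_eq)
  then show "0 \<le> deficit D a \<omega>" by (simp add: deficit_def abs_square_le_1)
qed (simp add: deficit_def)

lemma sum_block_increment:
  assumes "\<omega> \<in> space M" "0 \<le> a" "0 < D"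
  shows "N a \<omega> + (\<Sum>l<j. block_increment D a m l \<omega>) = N (a + real j * (D / real m)) \<omega>"
proof (induction j)
  case (Suc j)
  have "N (a + real j * (D / real m)) \<omega> \<le> N (a + real (Suc j) * (D / real m)) \<omega>"
    using assms by (intro N_mono) (auto intro!: divide_right_mono)
  then show ?case using Suc by (simp add: block_increment_def)
qed simp

text \<open>For a fixed path the number of jumps in the interval is a constant, so the Riemann sum
  error is of the order of the mesh.\<close>

lemma grid_deficit_tendsto:
  assumes \<omega>: "\<omega> \<in> space M" and "0 \<le> a" "0 < D"
  shows "(\<lambda>m. grid_deficit (Suc m) (\<lambda>j. block_increment D a (Suc m) j \<omega>)) \<longlonglongrightarrow> deficit D a \<omega>"
proof -
  define I where "I = (LBINT s:{a..a + D}. (-1) ^ N s \<omega> :: real)"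
  \<comment> \<open>Counting cells by \<open>Suc m\<close> excludes the empty grid.\<close>
  define R where "R m = D / real (Suc m) * (\<Sum>j<Suc m. (-1) ^ N (a + real j * (D / real (Suc m))) \<omega>)" for m
  have "\<bar>I - R m\<bar> \<le> 2 * D * (real (N (a + D) \<omega>) - real (N a \<omega>)) / real (Suc m)" for m
    using path_riemann_sum[OF \<omega> assms(2), of "D / real (Suc m)" "Suc m"] assms
    by (simp add: I_def R_def del: of_nat_Suc sum.lessThan_Suc)
  then have "\<forall>m. norm (R m - I) \<le> 2 * D * (real (N (a + D) \<omega>) - real (N a \<omega>)) / real (Suc m)"
    by (simp add: abs_minus_commute)
  moreover have "(\<lambda>m. 2 * D * (real (N (a + D) \<omega>) - real (N a \<omega>)) / real (Suc m)) \<longlonglongrightarrow> 0"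
    by (rule LIMSEQ_Suc[OF lim_const_over_n])
  ultimately have "(\<lambda>m. R m - I) \<longlonglongrightarrow> 0"
    by (rule Lim_null_comparison[OF always_eventually])
  then have "R \<longlonglongrightarrow> I" by (rule LIM_zero_cancel)
  then have "(\<lambda>m. 1 - (R m / D)\<^sup>2) \<longlonglongrightarrow> 1 - (I / D)\<^sup>2"
    using assms by (intro tendsto_intros) auto
  moreover have "1 - (R m / D)\<^sup>2 = grid_deficit (Suc m) (\<lambda>j. block_increment D a (Suc m) j \<omega>)" for m
  proof -
    have "(\<Sum>j<Suc m. (-1) ^ N (a + real j * (D / real (Suc m))) \<omega>)
      = (-1) ^ N a \<omega> * (\<Sum>j<Suc m. (-1) ^ (\<Sum>l<j. block_increment D a (Suc m) l \<omega>) :: real)"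
      unfolding sum_block_increment[OF assms, symmetric] power_add sum_distrib_left ..
    then have "R m / D = (-1) ^ N a \<omega> * ((\<Sum>j<Suc m. (-1) ^ (\<Sum>l<j. block_increment D a (Suc m) l \<omega>)) / real (Suc m))"
      using assms by (simp add: R_def del: of_nat_Suc sum.lessThan_Suc)
    moreover have "((-1 :: real) ^ N a \<omega>)\<^sup>2 = 1" by (cases "even (N a \<omega>)") auto
    ultimately show ?thesis
      by (simp add: grid_deficit_def power_mult_distrib power_divide del: of_nat_Suc sum.lessThan_Suc)
  qed
  ultimately show ?thesis by (simp add: deficit_def I_def)
qed

lemma block_increment_measurable [measurable]:
  assumes "0 \<le> a" "0 < D"
  shows "block_increment D a m j \<in> measurable M (count_space UNIV)"
proof -
  have [measurable]: "N (a + real j * (D / real m)) \<in> measurable M (count_space UNIV)"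
    "N (a + real (Suc j) * (D / real m)) \<in> measurable M (count_space UNIV)"
    using assms by (intro N_measurable; simp)+
  show ?thesis unfolding block_increment_def[abs_def] by measurable
qed

lemma borel_measurable_deficit:
  assumes "0 \<le> a" "0 < D"
  shows "deficit D a \<in> borel_measurable M"
  by (rule borel_measurable_LIMSEQ_real[OF grid_deficit_tendsto[OF _ assms]])
     (auto intro!: grid_deficit_measurable block_increment_measurable assms)

text \<open>The right-hand side does not involve \<open>a\<close>: this is the stationarity that
  makes the blocks identically distributed.\<close>

lemma distr_grid_deficit:
  assumes "0 \<le> a" "0 < D" "0 < m"
  shows "distr M borel (\<lambda>\<omega>. grid_deficit m (\<lambda>j. block_increment D a m j \<omega>))
    = distr (PiM {..<m} (\<lambda>_. measure_pmf (poisson_pmf (rate * (D / real m))))) borel (grid_deficit m)"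
proof -
  define t where "t j = a + real j * (D / real m)" for j
  have inc: "block_increment D a m j = (\<lambda>\<omega>. N (t (Suc j)) \<omega> - N (t j) \<omega>)" for j
    by (simp add: block_increment_def t_def fun_eq_iff)
  have t: "0 \<le> t j" "t j < t (Suc j)" for j
    using assms by (auto simp: t_def divide_strict_right_mono)
  have "indep_vars (\<lambda>_. count_space UNIV) (block_increment D a m) {..<m}"
    using N_indep_increments[of t m] t unfolding inc by (auto simp: mono_iff_le_Suc less_imp_le)
  then have "distr M (PiM {..<m} (\<lambda>_. count_space UNIV)) (\<lambda>\<omega>. \<lambda>j\<in>{..<m}. block_increment D a m j \<omega>)
      = PiM {..<m} (\<lambda>j. distr M (count_space UNIV) (block_increment D a m j))"
    by (subst (asm) indep_vars_iff_distr_eq_PiM')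
       (use assms in \<open>auto intro!: block_increment_measurable\<close>)
  also have "\<dots> = PiM {..<m} (\<lambda>_. measure_pmf (poisson_pmf (rate * (D / real m))))"
  proof (rule PiM_cong[OF refl])
    fix j
    have "t (Suc j) - t j = D / real m" by (simp add: t_def algebra_simps add_divide_distrib)
    then show "distr M (count_space UNIV) (block_increment D a m j) = measure_pmf (poisson_pmf (rate * (D / real m)))"
      using N_increment_distr[OF t(1) t(2), of j] by (simp add: inc)
  qed
  finally have *: "distr M (PiM {..<m} (\<lambda>_. count_space UNIV)) (\<lambda>\<omega>. \<lambda>j\<in>{..<m}. block_increment D a m j \<omega>) = \<dots>" .
  have meas: "grid_deficit m \<in> borel_measurable (PiM {..<m} (\<lambda>_. count_space UNIV))"
    by (rule grid_deficit_measurable) (rule measurable_component_singleton, simp)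
  have "distr M borel (\<lambda>\<omega>. grid_deficit m (\<lambda>j. block_increment D a m j \<omega>))
    = distr M borel (grid_deficit m \<circ> (\<lambda>\<omega>. \<lambda>j\<in>{..<m}. block_increment D a m j \<omega>))"
    by (rule arg_cong[where f = "distr M borel"]) (auto simp: fun_eq_iff grid_deficit_def intro!: sum.cong)
  also have "\<dots> = distr (distr M (PiM {..<m} (\<lambda>_. count_space UNIV)) (\<lambda>\<omega>. \<lambda>j\<in>{..<m}. block_increment D a m j \<omega>)) borel (grid_deficit m)"
    by (rule distr_distr[symmetric, OF meas])
       (auto intro!: measurable_restrict block_increment_measurable assms)
  finally show ?thesis unfolding * .
qed

text \<open>All blocks are cut from one grid of \<open>n * m\<close> cells, whose increments are
  jointly independent; block \<open>i\<close> is a function of the cells in \<open>K i\<close>, and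
  functions of disjoint groups of independent variables are independent.\<close>

lemma indep_vars_grid_deficit:
  assumes "0 < D" "0 < m"
  shows "indep_vars (\<lambda>_. borel)
    (\<lambda>i \<omega>. grid_deficit m (\<lambda>j. block_increment D (real i * D) m j \<omega>)) {..<n}"
proof -
  define t where "t k = real k * (D / real m)" for k
  define K where "K i = {i * m..<i * m + m}" for i
  have t: "0 \<le> t 0" "mono t"
    using assms by (auto simp: t_def mono_def intro!: divide_right_mono)
  have ind: "indep_vars (\<lambda>_. count_space UNIV) (\<lambda>k \<omega>. N (t (Suc k)) \<omega> - N (t k) \<omega>) {..<n * m}"
    by (rule N_indep_increments[OF t])
  have "indep_vars (\<lambda>i. PiM (K i) (\<lambda>_. count_space UNIV))
      (\<lambda>i \<omega>. \<lambda>k\<in>K i. N (t (Suc k)) \<omega> - N (t k) \<omega>) {..<n}"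
  proof (rule indep_vars_restrict[OF ind])
    show "K i \<subseteq> {..<n * m}" if "i \<in> {..<n}" for i
    proof -
      have "i * m + m \<le> n * m" using that mult_le_mono1[of "Suc i" n m] by simp
      then show ?thesis by (auto simp: K_def)
    qed
    show "disjoint_family_on K {..<n}"
    proof (unfold disjoint_family_on_def, intro ballI impI)
      \<comment> \<open>The block of a cell is recovered by division with remainder, so no cell
        belongs to two blocks.\<close>
      have "k div m = i" if "k \<in> K i" for k i
      proof -
        have "k = i * m + (k - i * m)" "k - i * m < m" using that by (auto simp: K_def)
        then show ?thesis by (metis div_mult_self3 div_less add.right_neutral assms(2) less_numeral_extra(3))
      qed
      then show "K i \<inter> K j = {}" if "i \<noteq> j" for i j using that by blast
    qed
  qed
  then have "indep_vars (\<lambda>_. borel)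
    (\<lambda>i \<omega>. grid_deficit m (\<lambda>j. (\<lambda>k\<in>K i. N (t (Suc k)) \<omega> - N (t k) \<omega>) (i * m + j))) {..<n}"
    by (rule indep_vars_compose2)
       (auto intro!: grid_deficit_measurable measurable_component_singleton simp: K_def)
  also have "(\<lambda>i \<omega>. grid_deficit m (\<lambda>j. (\<lambda>k\<in>K i. N (t (Suc k)) \<omega> - N (t k) \<omega>) (i * m + j)))
      = (\<lambda>i \<omega>. grid_deficit m (\<lambda>j. block_increment D (real i * D) m j \<omega>))"
  proof (intro ext)
    fix i \<omega>
    have "t (i * m + j) = real i * D + real j * (D / real m)" for j
      using assms by (simp add: t_def field_simps)
    from this this[of "Suc _"] show "grid_deficit m (\<lambda>j. (\<lambda>k\<in>K i. N (t (Suc k)) \<omega> - N (t k) \<omega>) (i * m + j))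
        = grid_deficit m (\<lambda>j. block_increment D (real i * D) m j \<omega>)"
      by (auto simp: grid_deficit_def block_increment_def K_def simp del: of_nat_Suc intro!: sum.cong)
  qed
  finally show ?thesis .
qed

text \<open>The increments of \<open>N\<close> on grids make the Riemann sums i.i.d.; the product formula then passes to
  the limit, so that no independence of the integrals themselves has to be derived.\<close>

lemma char_sum_deficit:
  assumes "0 < D"
  shows "char (distr M borel (\<lambda>\<omega>. \<Sum>i<n. deficit D (real i * D) \<omega>)) t
    = char (distr M borel (deficit D 0)) t ^ n"
proof (rule LIMSEQ_unique)
  let ?G = "\<lambda>m i \<omega>. grid_deficit (Suc m) (\<lambda>j. block_increment D (real i * D) (Suc m) j \<omega>)"
  have [measurable]: "?G m i \<in> borel_measurable M" for m i
    using assms by (intro grid_deficit_measurable block_increment_measurable) auto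
  show "(\<lambda>m. char (distr M borel (\<lambda>\<omega>. \<Sum>i<n. ?G m i \<omega>)) t)
    \<longlonglongrightarrow> char (distr M borel (\<lambda>\<omega>. \<Sum>i<n. deficit D (real i * D) \<omega>)) t"
    using assms by (intro char_distr_tendsto tendsto_sum grid_deficit_tendsto) auto
  have "(\<lambda>m. char (distr M borel (?G m 0)) t ^ n) \<longlonglongrightarrow> char (distr M borel (deficit D (real 0 * D))) t ^ n"
    using assms by (intro tendsto_power char_distr_tendsto grid_deficit_tendsto) auto
  moreover have "char (distr M borel (\<lambda>\<omega>. \<Sum>i<n. ?G m i \<omega>)) t = char (distr M borel (?G m 0)) t ^ n" for m
  proof -
    have "char (distr M borel (\<lambda>\<omega>. \<Sum>i<n. ?G m i \<omega>)) t = (\<Prod>i<n. char (distr M borel (?G m i)) t)"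
      using assms by (intro char_distr_sum indep_vars_grid_deficit) auto
    also have "\<dots> = (\<Prod>i<n. char (distr M borel (?G m 0)) t)"
      using assms by (intro prod.cong refl arg_cong2[where f = char]) (simp add: distr_grid_deficit)
    finally show ?thesis by simp
  qed
  ultimately show "(\<lambda>m. char (distr M borel (\<lambda>\<omega>. \<Sum>i<n. ?G m i \<omega>)) t) \<longlonglongrightarrow> char (distr M borel (deficit D 0)) t ^ n"
    by simp
qed

end

section \<open>Moments of the squared increments\<close>

lemma set_integral_FTC_Icc:
  fixes F f :: "real \<Rightarrow> real"
  assumes "a \<le> b" "\<And>x. a \<le> x \<Longrightarrow> x \<le> b \<Longrightarrow> (F has_real_derivative f x) (at x)" "continuous_on {a..b} f"
  shows "(LBINT x:{a..b}. f x) = F b - F a"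
proof -
  have "set_integrable lborel {a..b} f" by (rule borel_integrable_atLeastAtMost'[OF assms(3)])
  then have "(LBINT x:{a..b}. f x) = integral {a..b} f" by (rule set_borel_integral_eq_integral)
  also have "(f has_integral (F b - F a)) {a..b}"
    using assms(1,2) by (intro fundamental_theorem_of_calculus)
      (auto simp flip: has_real_derivative_iff_has_vector_derivative intro: has_field_derivative_at_within)
  then have "integral {a..b} f = F b - F a" by (rule integral_unique)
  finally show ?thesis .
qed

text \<open>The integrand is the correlation of the velocity signs at times \<open>s\<close> and
  \<open>u\<close>, so this is the second moment of the path integral over an interval of length
  \<open>D\<close>.\<close>

lemma double_integral_exp_abs_diff:
  fixes l :: real
  assumes "0 < l" "0 \<le> D"
  shows "(LBINT s:{0..D}. LBINT u:{0..D}. exp (- 2 * l * \<bar>s - u\<bar>))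
    = (D - (1 - exp (- 2 * l * D)) / (2 * l)) / l"
proof -
  have inner: "(LBINT u:{0..D}. exp (- 2 * l * \<bar>s - u\<bar>)) =
      (1 - exp (- 2 * l * s)) / (2 * l) + (1 - exp (- 2 * l * (D - s))) / (2 * l)"
    if s: "s \<in> {0..D}" for s
  proof -
    let ?f = "\<lambda>u. exp (- 2 * l * \<bar>s - u\<bar>)"
    have "set_integrable lborel {0..D} ?f"
      by (intro borel_integrable_atLeastAtMost' continuous_intros)
    then have "(LBINT u:{0..D}. ?f u) = integral {0..D} ?f" by (rule set_borel_integral_eq_integral)
    also have "\<dots> = (1 - exp (- 2 * l * s)) / (2 * l) + (1 - exp (- 2 * l * (D - s))) / (2 * l)"
    \<comment> \<open>Splitting at \<open>u = s\<close> removes the absolute value.\<close>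
    proof (rule integral_unique, rule has_integral_combine[of 0 s D])
      have "((\<lambda>u. exp (- 2 * l * (s - u))) has_integral
          exp (- 2 * l * (s - s)) / (2 * l) - exp (- 2 * l * (s - 0)) / (2 * l)) {0..s}"
        using s assms by (intro fundamental_theorem_of_calculus)
          (auto simp flip: has_real_derivative_iff_has_vector_derivative intro!: derivative_eq_intros)
      also have "?this \<longleftrightarrow> (?f has_integral exp (- 2 * l * (s - s)) / (2 * l) - exp (- 2 * l * (s - 0)) / (2 * l)) {0..s}"
        by (rule has_integral_cong) auto
      finally show "(?f has_integral (1 - exp (- 2 * l * s)) / (2 * l)) {0..s}"
        by (simp add: diff_divide_distrib)
      have "((\<lambda>u. exp (- 2 * l * (u - s))) has_integral
          (- exp (- 2 * l * (D - s)) / (2 * l)) - (- exp (- 2 * l * (s - s)) / (2 * l))) {s..D}"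
        using s assms by (intro fundamental_theorem_of_calculus)
          (auto simp flip: has_real_derivative_iff_has_vector_derivative intro!: derivative_eq_intros)
      also have "?this \<longleftrightarrow> (?f has_integral (- exp (- 2 * l * (D - s)) / (2 * l)) - (- exp (- 2 * l * (s - s)) / (2 * l))) {s..D}"
        by (rule has_integral_cong) auto
      finally show "(?f has_integral (1 - exp (- 2 * l * (D - s))) / (2 * l)) {s..D}"
        by (simp add: diff_divide_distrib)
    qed (use s in auto)
    finally show ?thesis .
  qed
  let ?F = "\<lambda>s. (s + exp (- 2 * l * s) / (2 * l)) / (2 * l) + (s - exp (- 2 * l * (D - s)) / (2 * l)) / (2 * l)"
  have "(LBINT s:{0..D}. LBINT u:{0..D}. exp (- 2 * l * \<bar>s - u\<bar>)) =
    (LBINT s:{0..D}. (1 - exp (- 2 * l * s)) / (2 * l) + (1 - exp (- 2 * l * (D - s))) / (2 * l))"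
    using inner by (intro set_lebesgue_integral_cong) auto
  also have "\<dots> = ?F D - ?F 0"
  proof (rule set_integral_FTC_Icc[OF assms(2)])
    show "(?F has_real_derivative (1 - exp (- 2 * l * s)) / (2 * l) + (1 - exp (- 2 * l * (D - s))) / (2 * l)) (at s)" for s
      using assms by (auto intro!: derivative_eq_intros simp: field_simps)
  qed (use assms in \<open>auto intro!: continuous_intros\<close>)
  also have "\<dots> = (D - (1 - exp (- 2 * l * D)) / (2 * l)) / l"
    using assms by (simp add: field_simps)
  finally show ?thesis .
qed

text \<open>Fubini's theorem: the bound dominates the integrand by a multiple of the indicator of
  \<open>{a..b} \<times> space M\<close>, a rectangle of finite measure.\<close>

lemma (in prob_space) expectation_interval_integral:
  fixes f :: "real \<Rightarrow> 'a \<Rightarrow> real"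
  assumes meas: "(\<lambda>p. f (fst p) (snd p)) \<in> borel_measurable (lborel \<Otimes>\<^sub>M M)"
    and bd: "\<And>s \<omega>. s \<in> {a..b} \<Longrightarrow> \<omega> \<in> space M \<Longrightarrow> \<bar>f s \<omega>\<bar> \<le> B"
  shows "expectation (\<lambda>\<omega>. LBINT s:{a..b}. f s \<omega>) = (LBINT s:{a..b}. expectation (f s))"
proof -
  interpret P: pair_sigma_finite lborel M ..
  note [measurable] = meas
  have "integrable (lborel \<Otimes>\<^sub>M M) (\<lambda>p. indicator {a..b} (fst p) *\<^sub>R f (fst p) (snd p))"
  proof (rule Bochner_Integration.integrable_bound)
    have "emeasure (lborel \<Otimes>\<^sub>M M) ({a..b} \<times> space M) < \<infinity>"
      by (simp add: emeasure_pair_measure_Times emeasure_space_1 emeasure_lborel_Icc_eq)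
    then show "integrable (lborel \<Otimes>\<^sub>M M) (\<lambda>p. \<bar>B\<bar> * indicator ({a..b} \<times> space M) p)"
      by (intro integrable_mult_right) simp
    show "AE p in lborel \<Otimes>\<^sub>M M. norm (indicator {a..b} (fst p) *\<^sub>R f (fst p) (snd p)) \<le> norm (\<bar>B\<bar> * indicator ({a..b} \<times> space M) p)"
    proof (rule AE_I2)
      fix p :: "real \<times> 'a" assume "p \<in> space (lborel \<Otimes>\<^sub>M M)"
      then have "snd p \<in> space M" by (auto simp: space_pair_measure)
      then show "norm (indicator {a..b} (fst p) *\<^sub>R f (fst p) (snd p)) \<le> norm (\<bar>B\<bar> * indicator ({a..b} \<times> space M) p)"
        using bd[of "fst p" "snd p"] by (cases p) (auto simp: indicator_def)
    qed
  qed measurable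
  then have "integrable (lborel \<Otimes>\<^sub>M M) (\<lambda>(s, \<omega>). indicator {a..b} s *\<^sub>R f s \<omega>)"
    by (simp add: case_prod_beta')
  from P.Fubini_integral[OF this] show ?thesis
    by (simp add: set_lebesgue_integral_def)
qed

text \<open>The Poisson generating function at -1: the exponential series at \<open>- r\<close>
  contributes a second factor \<open>exp (- r)\<close>.\<close>

lemma poisson_expectation_minus_one_power:
  assumes "0 < r"
  shows "measure_pmf.expectation (poisson_pmf r) (\<lambda>k. (-1) ^ k :: real) = exp (- 2 * r)"
proof -
  have sums: "(\<lambda>k. pmf (poisson_pmf r) k * (-1) ^ k) sums (exp (- r) * exp (- r))"
    using sums_mult[OF exp_converges[of "- r"], of "exp (- r)"] assms
    by (simp add: divide_inverse power_minus[of r] mult_ac)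
  have "summable (\<lambda>k. exp (- r) * (inverse (fact k) * r ^ k))"
    by (intro summable_mult summable_exp)
  then have "summable (\<lambda>k. norm (pmf (poisson_pmf r) k * (-1) ^ k))"
    using assms by (simp add: abs_mult divide_inverse mult_ac)
  then have "integrable (count_space UNIV) (\<lambda>k. pmf (poisson_pmf r) k * (-1) ^ k)"
    by (simp add: integrable_count_space_nat_iff)
  from sums_integral_count_space_nat[OF this] sums
  have "(\<integral>k. pmf (poisson_pmf r) k * (-1) ^ k \<partial>count_space UNIV) = exp (- r) * exp (- r)"
    by (rule sums_unique2)
  then show ?thesis
    unfolding measure_pmf_eq_density[of "poisson_pmf r"]
    by (subst integral_density) (simp_all flip: exp_add)
qed

context poisson_process
begin

lemma prob_increment:
  assumes "0 \<le> s" "s < t"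
  shows "prob {\<omega> \<in> space M. N t \<omega> - N s \<omega> = k} = pmf (poisson_pmf (rate * (t - s))) k"
proof -
  have [measurable]: "N t \<in> measurable M (count_space UNIV)" "N s \<in> measurable M (count_space UNIV)"
    using assms by (auto intro: N_measurable)
  have "pmf (poisson_pmf (rate * (t - s))) k
      = measure (distr M (count_space UNIV) (\<lambda>\<omega>. N t \<omega> - N s \<omega>)) {k}"
    unfolding N_increment_distr[OF assms] by (simp add: measure_pmf_single)
  also have "\<dots> = prob {\<omega> \<in> space M. N t \<omega> - N s \<omega> = k}"
    by (subst measure_distr) (auto intro!: arg_cong[where f = prob])
  finally show ?thesis ..
qed

text \<open>For ordered times the jumps before the earlier one cancel in the product, leaving the
  parity of a single Poisson increment.\<close>

lemma expectation_sign_product: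
  assumes "0 \<le> s" "0 \<le> t"
  shows "expectation (\<lambda>\<omega>. (-1) ^ N s \<omega> * (-1) ^ N t \<omega>) = exp (- 2 * rate * \<bar>s - t\<bar>)"
proof -
  have lt: "expectation (\<lambda>\<omega>. (-1) ^ N s \<omega> * (-1) ^ N t \<omega>) = exp (- 2 * rate * (t - s))"
    if "0 \<le> s" "s < t" for s t
  proof -
    have [measurable]: "N t \<in> measurable M (count_space UNIV)" "N s \<in> measurable M (count_space UNIV)"
      using that by (auto intro: N_measurable)
    have "expectation (\<lambda>\<omega>. (-1) ^ N s \<omega> * (-1) ^ N t \<omega>) = expectation (\<lambda>\<omega>. (-1) ^ (N t \<omega> - N s \<omega>) :: real)"
    proof (rule Bochner_Integration.integral_cong[OF refl])
      fix \<omega> assume "\<omega> \<in> space M"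
      then have "N s \<omega> \<le> N t \<omega>" using that by (intro N_mono) auto
      then obtain d where "N t \<omega> = N s \<omega> + d" by (auto simp: le_iff_add)
      then show "(-1) ^ N s \<omega> * (-1) ^ N t \<omega> = ((-1) ^ (N t \<omega> - N s \<omega>) :: real)"
        by (simp add: power_add flip: mult.assoc power_mult_distrib)
    qed
    also have "\<dots> = integral\<^sup>L (distr M (count_space UNIV) (\<lambda>\<omega>. N t \<omega> - N s \<omega>)) (\<lambda>k. (-1) ^ k)"
      by (subst integral_distr) auto
    also have "\<dots> = exp (- 2 * (rate * (t - s)))"
      unfolding N_increment_distr[OF that]
      using that rate_pos by (intro poisson_expectation_minus_one_power) auto
    finally show ?thesis by (simp add: algebra_simps)
  qed
  consider "s < t" | "t < s" | "s = t" by linarith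
  then show ?thesis
  proof cases
    case 1
    then show ?thesis using lt[of s t] assms by simp
  next
    case 2
    then show ?thesis using lt[of t s] assms by (simp add: mult.commute)
  next
    case 3
    have "(-1) ^ k * (-1) ^ k = (1 :: real)" for k by (simp flip: power_mult_distrib)
    then show ?thesis using 3 by (simp add: prob_space)
  qed
qed

text \<open>The squared path integral is a double integral of sign products; two uses of Fubini
  bring the expectation inside.\<close>

lemma expectation_deficit:
  assumes "0 < D"
  shows "expectation (deficit D 0) = mean_deficit (rate * D)"
proof -
  \<comment> \<open>A version of the sign that is bounded and jointly measurable on the whole line
    and agrees with \<open>(-1) ^ N s\<close> for \<open>s \<ge> 0\<close>.\<close>
  define g where "g s \<omega> = cos (pi * real (N (max 0 s) \<omega>))" for s \<omega>
  have g: "g s \<omega> = (-1) ^ N s \<omega>" if "0 \<le> s" for s \<omega> using that by (simp add: g_def)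
  have gbd: "\<bar>g s \<omega>\<bar> \<le> 1" for s \<omega> by (simp add: g_def del: cos_npi cos_npi2)
  have gm [measurable]: "(\<lambda>p. g (fst p) (snd p)) \<in> borel_measurable (lborel \<Otimes>\<^sub>M M)"
    unfolding g_def by measurable
  have [measurable]: "g s \<in> borel_measurable M" for s
  proof -
    have [measurable]: "(\<lambda>\<omega>. real (N (max 0 s) \<omega>)) \<in> borel_measurable M" by (rule borel_measurable_N) simp
    show ?thesis unfolding g_def[abs_def] by measurable
  qed
  define J where "J \<omega> = (LBINT u:{0..D}. g u \<omega>)" for \<omega>
  have [measurable]: "J \<in> borel_measurable M"
  proof -
    have "(\<lambda>p. g (snd p) (fst p)) \<in> borel_measurable (M \<Otimes>\<^sub>M lborel)"
      using measurable_compose[OF measurable_pair_swap' gm] by (simp add: case_prod_beta)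
    then have meas: "(\<lambda>(\<omega>, u). indicator {0..D} u *\<^sub>R g u \<omega>) \<in> borel_measurable (M \<Otimes>\<^sub>M lborel)"
      unfolding case_prod_beta' by measurable
    show ?thesis unfolding J_def[abs_def] set_lebesgue_integral_def
      by (rule lborel.borel_measurable_lebesgue_integral[OF meas])
  qed
  have J: "J \<omega> = (LBINT s:{0..D}. (-1) ^ N s \<omega>)" for \<omega>
    unfolding J_def using g by (intro set_lebesgue_integral_cong) auto
  have Jbd: "\<bar>J \<omega>\<bar> \<le> D" if "\<omega> \<in> space M" for \<omega>
    unfolding J using path_integral_bound[OF that, of 0 D] assms by simp
  have "expectation (\<lambda>\<omega>. (J \<omega>)\<^sup>2) = expectation (\<lambda>\<omega>. LBINT s:{0..D}. g s \<omega> * J \<omega>)"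
    by (simp add: J_def power2_eq_square)
  also have "\<dots> = (LBINT s:{0..D}. expectation (\<lambda>\<omega>. g s \<omega> * J \<omega>))"
  proof (rule expectation_interval_integral[where B = D])
    fix s \<omega> assume "s \<in> {0..D}" "\<omega> \<in> space M"
    then show "\<bar>g s \<omega> * J \<omega>\<bar> \<le> D"
      using mult_mono[OF gbd[of s \<omega>] Jbd[of \<omega>]] by (simp add: abs_mult)
  qed measurable
  also have "\<dots> = (LBINT s:{0..D}. LBINT u:{0..D}. exp (- 2 * rate * \<bar>s - u\<bar>))"
  proof (intro set_lebesgue_integral_cong allI impI)
    fix s assume s: "s \<in> {0..D}"
    have "expectation (\<lambda>\<omega>. g s \<omega> * J \<omega>) = expectation (\<lambda>\<omega>. LBINT u:{0..D}. g s \<omega> * g u \<omega>)"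
      by (simp add: J_def)
    also have "\<dots> = (LBINT u:{0..D}. expectation (\<lambda>\<omega>. g s \<omega> * g u \<omega>))"
    proof (rule expectation_interval_integral[where B = 1])
      fix u \<omega>
      show "\<bar>g s \<omega> * g u \<omega>\<bar> \<le> 1"
        using mult_mono[OF gbd[of s \<omega>] gbd[of u \<omega>]] by (simp add: abs_mult)
    qed measurable
    also have "\<dots> = (LBINT u:{0..D}. exp (- 2 * rate * \<bar>s - u\<bar>))"
      using s by (intro set_lebesgue_integral_cong allI impI) (simp_all add: g expectation_sign_product)
    finally show "expectation (\<lambda>\<omega>. g s \<omega> * J \<omega>) = (LBINT u:{0..D}. exp (- 2 * rate * \<bar>s - u\<bar>))" .
  qed simp
  also have "\<dots> = (D - (1 - exp (- 2 * rate * D)) / (2 * rate)) / rate"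
    using assms rate_pos by (intro double_integral_exp_abs_diff) auto
  finally have E: "expectation (\<lambda>\<omega>. (J \<omega>)\<^sup>2) = \<dots>" .
  have "integrable M (\<lambda>\<omega>. (J \<omega>)\<^sup>2)"
  proof (rule integrable_const_bound)
    show "AE \<omega> in M. norm ((J \<omega>)\<^sup>2) \<le> D\<^sup>2"
      using Jbd by (intro AE_I2) (simp, metis abs_ge_zero power2_abs power_mono)
  qed measurable
  then have "expectation (\<lambda>\<omega>. 1 - (J \<omega>)\<^sup>2 / D\<^sup>2) = 1 - expectation (\<lambda>\<omega>. (J \<omega>)\<^sup>2) / D\<^sup>2"
    by (subst Bochner_Integration.integral_diff) (auto simp: prob_space)
  then show ?thesis
    using assms rate_pos unfolding E
    by (simp add: deficit_def[abs_def] J[symmetric] power_divide mean_deficit_def field_simps power2_eq_square)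
qed

text \<open>If there is exactly one jump in \<open>[0, D]\<close> then \<open>c\<close> is its time; integrating a derivative
  against the indicator of \<open>N s = 0\<close> expresses functions of the jump time by values of \<open>N\<close>
  at fixed times.\<close>

lemma single_jump_path:
  assumes \<omega>: "\<omega> \<in> space M" and "0 \<le> D" and one: "N D \<omega> = 1"
  obtains c where "0 \<le> c" "c \<le> D"
    "\<And>h h'. (\<And>x. (h has_real_derivative h' x) (at x)) \<Longrightarrow> continuous_on UNIV h' \<Longrightarrow>
      (LBINT s:{0..D}. h' s * indicator {0} (real (N (max 0 s) \<omega>))) = h c - h 0"
proof -
  define S where "S = {s \<in> {0..D}. N s \<omega> = 0}"
  define c where "c = Sup S"
  have "0 \<in> S" using N_zero[OF \<omega>] assms by (simp add: S_def)
  have bdd: "bdd_above S" by (auto simp: S_def bdd_above_def)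
  have c: "0 \<le> c" "c \<le> D"
    unfolding c_def using \<open>0 \<in> S\<close> bdd by (auto intro!: cSup_upper cSup_least simp: S_def)
  have before: "N s \<omega> = 0" if "0 \<le> s" "s < c" for s
  proof -
    have "s < Sup S" "S \<noteq> {}" using that \<open>0 \<in> S\<close> by (auto simp: c_def)
    then obtain x where "x \<in> S" "s < x" by (rule less_cSupE)
    then show ?thesis using N_mono[OF \<omega> that(1), of x] by (auto simp: S_def)
  qed
  have after: "N s \<omega> \<noteq> 0" if "c < s" "s \<le> D" for s
  proof
    assume "N s \<omega> = 0"
    then have "s \<in> S" using that c by (auto simp: S_def)
    then have "s \<le> c" unfolding c_def using bdd by (rule cSup_upper)
    then show False using that by simp
  qed
  have "(LBINT s:{0..D}. h' s * indicator {0} (real (N (max 0 s) \<omega>))) = h c - h 0"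
    if h: "\<And>x. (h has_real_derivative h' x) (at x)" "continuous_on UNIV h'" for h h' :: "real \<Rightarrow> real"
  proof -
    have [measurable]: "h' \<in> borel_measurable borel"
      using h(2) by (rule borel_measurable_continuous_onI)
    have [measurable]: "(\<lambda>s. real (N (max 0 s) \<omega>)) \<in> borel_measurable borel"
      by (rule borel_measurable_N_path[OF \<omega>])
    have "(LBINT s:{0..D}. h' s * indicator {0} (real (N (max 0 s) \<omega>))) = (LBINT s:{0..c}. h' s)"
      unfolding set_lebesgue_integral_def
    proof (rule integral_cong_AE)
      show "AE s in lborel. indicator {0..D} s *\<^sub>R (h' s * indicator {0} (real (N (max 0 s) \<omega>))) = indicator {0..c} s *\<^sub>R h' s"
        \<comment> \<open>Nothing is known about the value of the path at \<open>c\<close> itself; a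
          single point is a Lebesgue null set.\<close>
        using AE_lborel_singleton[of c]
      proof eventually_elim
        case (elim s)
        show ?case
          using elim c before[of s] after[of s] by (cases "s < c") (auto simp: indicator_def)
      qed
    qed measurable
    also have "\<dots> = h c - h 0"
      using c h by (intro set_integral_FTC_Icc) (auto intro: continuous_on_subset)
    finally show ?thesis .
  qed
  with c that show ?thesis by blast
qed

text \<open>The event prescribes the increments over \<open>[0, s]\<close> and
  \<open>[s, D]\<close>, so its probability factorises. The ends \<open>s = 0\<close> and
  \<open>s = D\<close> are separate because the increment law is stated for intervals of positive
  length.\<close>

lemma prob_single_jump_after:
  assumes "0 \<le> s" "s \<le> D" "0 < D"
  shows "prob {\<omega> \<in> space M. N s \<omega> = 0 \<and> N D \<omega> = 1} = rate * (D - s) * exp (- rate * D)"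
proof -
  have inc0: "N t \<omega> - N 0 \<omega> = N t \<omega>" if "\<omega> \<in> space M" for t \<omega> using N_zero[OF that] by simp
  consider "s = 0" | "s = D" | "0 < s" "s < D" using assms by linarith
  then show ?thesis
  proof cases
    case 1
    have "{\<omega> \<in> space M. N s \<omega> = 0 \<and> N D \<omega> = 1} = {\<omega> \<in> space M. N D \<omega> - N 0 \<omega> = 1}"
      using 1 N_zero by auto
    then show ?thesis using prob_increment[of 0 D 1] assms 1 rate_pos by simp
  next
    case 2
    then have "{\<omega> \<in> space M. N s \<omega> = 0 \<and> N D \<omega> = 1} = {}" by auto
    then show ?thesis using 2 by (metis diff_self measure_empty mult_zero_left mult_zero_right)
  next
    case 3
    define t where "t i = (if i = 0 then 0 else if i = 1 then s else D)" for i :: nat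
    have "mono t" using 3 by (intro incseq_SucI) (auto simp: t_def)
    then have ind: "indep_vars (\<lambda>_. count_space UNIV) (\<lambda>i \<omega>. N (t (Suc i)) \<omega> - N (t i) \<omega>) {..<2}"
      by (intro N_indep_increments) (simp_all add: t_def[of 0])
    \<comment> \<open>The index doubles as the prescribed value: increment 0 must be 0 and increment
      1 must be 1.\<close>
    have "prob (\<Inter>i\<in>{..<2}. (\<lambda>\<omega>. N (t (Suc i)) \<omega> - N (t i) \<omega>) -` {i} \<inter> space M)
        = (\<Prod>i\<in>{..<2}. prob ((\<lambda>\<omega>. N (t (Suc i)) \<omega> - N (t i) \<omega>) -` {i} \<inter> space M))"
      by (rule indep_varsD[OF ind]) (auto simp: numeral_2_eq_2 lessThan_Suc)
    also have "(\<Inter>i\<in>{..<2}. (\<lambda>\<omega>. N (t (Suc i)) \<omega> - N (t i) \<omega>) -` {i} \<inter> space M)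
        = {\<omega> \<in> space M. N s \<omega> = 0 \<and> N D \<omega> = 1}"
      by (auto simp: numeral_2_eq_2 lessThan_Suc t_def N_zero)
    also have "(\<Prod>i\<in>{..<2}. prob ((\<lambda>\<omega>. N (t (Suc i)) \<omega> - N (t i) \<omega>) -` {i} \<inter> space M))
        = prob {\<omega> \<in> space M. N s \<omega> - N 0 \<omega> = 0} * prob {\<omega> \<in> space M. N D \<omega> - N s \<omega> = 1}"
      by (simp add: numeral_2_eq_2 lessThan_Suc t_def vimage_def Int_def conj_commute)
    also have "\<dots> = exp (- (rate * s)) * (rate * (D - s) * exp (- (rate * (D - s))))"
      using 3 rate_pos prob_increment[of 0 s 0] prob_increment[of s D 1] by simp
    also have "\<dots> = rate * (D - s) * (exp (- (rate * s)) * exp (- (rate * (D - s))))" by simp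
    also have "exp (- (rate * s)) * exp (- (rate * (D - s))) = exp (- rate * D)"
      by (simp add: algebra_simps flip: exp_add)
    finally show ?thesis .
  qed
qed

lemma expectation_deficit_square_single_jump:
  assumes "0 < D"
  shows "expectation (\<lambda>\<omega>. (deficit D 0 \<omega>)\<^sup>2 * indicator {1} (real (N D \<omega>)))
    = 8 / 15 * (rate * D) * exp (- rate * D)"
proof -
  define h where "h s = (1 - ((2 * s - D) / D)\<^sup>2)\<^sup>2" for s
  define h' where "h' s = - 8 * (1 - ((2 * s - D) / D)\<^sup>2) * ((2 * s - D) / D) / D" for s
  have h: "(h has_real_derivative h' x) (at x)" for x
  proof -
    define w where "w s = (2 * s - D) / D" for s
    have w: "(w has_real_derivative 2 / D) (at x)"
      unfolding w_def[abs_def] using assms by (auto intro!: derivative_eq_intros)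
    have "((\<lambda>s. (1 - (w s)\<^sup>2)\<^sup>2) has_real_derivative 2 * (1 - (w x)\<^sup>2) * (- (2 * w x * (2 / D)))) (at x)"
      by (auto intro!: derivative_eq_intros w)
    moreover have "h = (\<lambda>s. (1 - (w s)\<^sup>2)\<^sup>2)" by (simp add: h_def w_def fun_eq_iff)
    moreover have "h' x = 2 * (1 - (w x)\<^sup>2) * (- (2 * w x * (2 / D)))"
      unfolding h'_def w_def[symmetric] using assms by (simp add: field_simps)
    ultimately show ?thesis by simp
  qed
  have h': "continuous_on UNIV h'" unfolding h'_def[abs_def] using assms by (intro continuous_intros) auto
  have [measurable]: "h' \<in> borel_measurable borel" using h' by (rule borel_measurable_continuous_onI)
  have [measurable]: "(\<lambda>\<omega>. real (N D \<omega>)) \<in> borel_measurable M" using assms by (intro borel_measurable_N) simp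
  have eq: "(deficit D 0 \<omega>)\<^sup>2 * indicator {1} (real (N D \<omega>))
      = (LBINT s:{0..D}. h' s * indicator {0} (real (N (max 0 s) \<omega>)) * indicator {1} (real (N D \<omega>)))"
    if \<omega>: "\<omega> \<in> space M" for \<omega>
  proof (cases "N D \<omega> = 1")
    case True
    obtain c where c: "0 \<le> c" "c \<le> D"
      "\<And>h h'. (\<And>x. (h has_real_derivative h' x) (at x)) \<Longrightarrow> continuous_on UNIV h' \<Longrightarrow>
      (LBINT s:{0..D}. h' s * indicator {0} (real (N (max 0 s) \<omega>))) = h c - h 0"
      by (rule single_jump_path[OF \<omega> less_imp_le[OF assms] True]) blast
    \<comment> \<open>The sign is 1 before the jump and -1 after it, so the integral is
      \<open>c - (D - c) = 2 * c - D\<close>.\<close>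
    have "(LBINT s:{0..D}. (-1) ^ N s \<omega> :: real) = (LBINT s:{0..D}. 2 * indicator {0} (real (N (max 0 s) \<omega>)) - 1)"
    proof (intro set_lebesgue_integral_cong allI impI)
      fix s assume s: "s \<in> {0..D}"
      then have "N s \<omega> = 0 \<or> N s \<omega> = 1" using N_mono[OF \<omega>, of s D] True by auto
      then show "(-1) ^ N s \<omega> = 2 * indicator {0} (real (N (max 0 s) \<omega>)) - (1::real)" using s by auto
    qed simp
    also have "\<dots> = (LBINT s:{0..D}. 2 * indicator {0} (real (N (max 0 s) \<omega>))) - (LBINT s:{0..D}. 1)"
    proof (rule set_integral_diff)
      have [measurable]: "(\<lambda>s. real (N (max 0 s) \<omega>)) \<in> borel_measurable borel"
        by (rule borel_measurable_N_path[OF \<omega>])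
      show "set_integrable lborel {0..D} (\<lambda>s. 2 * indicator {0} (real (N (max 0 s) \<omega>)) :: real)"
        unfolding set_integrable_def
        by (rule Bochner_Integration.integrable_bound[of _ "\<lambda>s. 2 * indicator {0..D} s :: real"])
           (auto simp: emeasure_lborel_Icc_eq split: split_indicator)
      show "set_integrable lborel {0..D} (\<lambda>s. 1 :: real)"
        by (intro borel_integrable_atLeastAtMost' continuous_intros)
    qed
    also have "(LBINT s:{0..D}. 2 * indicator {0} (real (N (max 0 s) \<omega>)) :: real) = 2 * c - 2 * 0"
      by (rule c(3)) (auto intro!: derivative_eq_intros)
    also have "(LBINT s:{0..D}. 1 :: real) = D" using assms by (simp add: set_lebesgue_integral_def)
    finally have "(deficit D 0 \<omega>)\<^sup>2 = h c" by (simp add: deficit_def h_def)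
    \<comment> \<open>At \<open>s = 0\<close> the inner square is 1, hence
      \<open>h 0 = 0\<close>.\<close>
    also have "h c = h c - h 0" using assms by (simp add: h_def)
    also have "\<dots> = (LBINT s:{0..D}. h' s * indicator {0} (real (N (max 0 s) \<omega>)))"
      by (rule c(3)[OF h h', symmetric])
    finally show ?thesis using True by simp
  qed (simp add: indicator_def)
  have bd: "\<bar>h' s\<bar> \<le> 8 / D" if "s \<in> {0..D}" for s
  proof -
    define w where "w = (2 * s - D) / D"
    have w: "\<bar>w\<bar> \<le> 1" using that assms by (auto simp: w_def abs_le_iff field_simps)
    then have "w\<^sup>2 \<le> 1" by (simp add: abs_square_le_1)
    then have "\<bar>1 - w\<^sup>2\<bar> \<le> 1" by simp
    then have "\<bar>1 - w\<^sup>2\<bar> * \<bar>w\<bar> \<le> 1 * 1" using w by (intro mult_mono) auto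
    then have "8 * (\<bar>1 - w\<^sup>2\<bar> * \<bar>w\<bar>) / D \<le> 8 / D" using assms by (intro divide_right_mono) auto
    moreover have "\<bar>h' s\<bar> = 8 * (\<bar>1 - w\<^sup>2\<bar> * \<bar>w\<bar>) / D"
    proof -
      have "h' s = - (8 * ((1 - w\<^sup>2) * w) / D)" unfolding h'_def w_def[symmetric] using assms by (simp add: field_simps)
      then show ?thesis using assms by (simp add: abs_mult)
    qed
    ultimately show ?thesis by simp
  qed
  have "expectation (\<lambda>\<omega>. (deficit D 0 \<omega>)\<^sup>2 * indicator {1} (real (N D \<omega>)))
    = expectation (\<lambda>\<omega>. LBINT s:{0..D}. h' s * indicator {0} (real (N (max 0 s) \<omega>)) * indicator {1} (real (N D \<omega>)))"
    using eq by (intro Bochner_Integration.integral_cong) auto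
  also have "\<dots> = (LBINT s:{0..D}. expectation (\<lambda>\<omega>. h' s * indicator {0} (real (N (max 0 s) \<omega>)) * indicator {1} (real (N D \<omega>))))"
  proof (rule expectation_interval_integral[where B = "8 / D"])
    fix s \<omega> assume "s \<in> {0..D}"
    then show "\<bar>h' s * indicator {0} (real (N (max 0 s) \<omega>)) * indicator {1} (real (N D \<omega>))\<bar> \<le> 8 / D"
      using bd[of s] assms by (auto simp: indicator_def)
  qed measurable
  also have "\<dots> = (LBINT s:{0..D}. h' s * (rate * (D - s) * exp (- rate * D)))"
  proof (intro set_lebesgue_integral_cong allI impI)
    fix s assume s: "s \<in> {0..D}"
    have "expectation (\<lambda>\<omega>. h' s * indicator {0} (real (N (max 0 s) \<omega>)) * indicator {1} (real (N D \<omega>)))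
      = expectation (\<lambda>\<omega>. h' s * indicator {\<omega> \<in> space M. N s \<omega> = 0 \<and> N D \<omega> = 1} \<omega>)"
      using s by (intro Bochner_Integration.integral_cong) (auto simp: indicator_def)
    also have "\<dots> = h' s * prob {\<omega> \<in> space M. N s \<omega> = 0 \<and> N D \<omega> = 1}"
      by (simp add: Int_def conj_commute)
    finally show "expectation (\<lambda>\<omega>. h' s * indicator {0} (real (N (max 0 s) \<omega>)) * indicator {1} (real (N D \<omega>)))
      = h' s * (rate * (D - s) * exp (- rate * D))"
      using s assms prob_single_jump_after[of s D] by simp
  qed simp
  also have "\<dots> = 8 / 15 * (rate * D) * exp (- rate * D)"
  proof -
    \<comment> \<open>An antiderivative of \<open>h\<close>: with \<open>t = s / D\<close>,
      \<open>h\<close> is \<open>16 * (t\<^sup>2 - 2 * t ^ 3 + t ^ 4)\<close>. At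
      \<open>t = 1\<close> the bracket in \<open>H\<close> is
      \<open>1 / 3 - 1 / 2 + 1 / 5 = 1 / 30\<close>, whence \<open>8 / 15\<close>.\<close>
    define H where "H s = 16 * D * ((s / D) ^ 3 / 3 - (s / D) ^ 4 / 2 + (s / D) ^ 5 / 5)" for s
    have H: "(H has_real_derivative h x) (at x)" for x
    proof -
      define w where "w s = s / D" for s
      have w: "(w has_real_derivative 1 / D) (at x)"
        unfolding w_def[abs_def] using assms by (auto intro!: derivative_eq_intros)
      have "((\<lambda>s. 16 * D * (w s ^ 3 / 3 - w s ^ 4 / 2 + w s ^ 5 / 5)) has_real_derivative
          16 * (w x ^ 2 - 2 * w x ^ 3 + w x ^ 4)) (at x)"
        using assms by (auto intro!: derivative_eq_intros w simp: field_simps)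
      then have "(H has_real_derivative 16 * ((x / D) ^ 2 - 2 * (x / D) ^ 3 + (x / D) ^ 4)) (at x)"
        by (simp only: w_def H_def[abs_def])
      moreover have poly: "(1 - (2 * t - 1)\<^sup>2)\<^sup>2 = 16 * (t\<^sup>2 - 2 * t ^ 3 + t ^ 4)" for t :: real
        by (simp add: power2_eq_square power3_eq_cube power4_eq_xxxx algebra_simps)
      have "(2 * x - D) / D = 2 * (x / D) - 1" using assms by (simp add: field_simps)
      then have "h x = 16 * ((x / D) ^ 2 - 2 * (x / D) ^ 3 + (x / D) ^ 4)"
        using poly[of "x / D"] by (simp only: h_def)
      ultimately show ?thesis by simp
    qed
    \<comment> \<open>Integration by parts: the term \<open>- h\<close> from differentiating
      \<open>D - s\<close> is cancelled by the derivative of \<open>H\<close>.\<close>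
    have "((\<lambda>s. (h s * (D - s) + H s) * (rate * exp (- rate * D))) has_real_derivative
        h' x * (rate * (D - x) * exp (- rate * D))) (at x)" for x
      by (rule derivative_eq_intros h H refl)+ (simp add: algebra_simps)
    then have "(LBINT s:{0..D}. h' s * (rate * (D - s) * exp (- rate * D)))
      = (h D * (D - D) + H D) * (rate * exp (- rate * D)) - (h 0 * (D - 0) + H 0) * (rate * exp (- rate * D))"
      using assms by (intro set_integral_FTC_Icc) (auto intro!: continuous_intros continuous_on_subset[OF h'])
    also have "\<dots> = H D * (rate * exp (- rate * D))"
      using assms by (simp add: h_def H_def)
    also have "H D = 8 / 15 * D"
      using assms by (simp add: H_def)
    finally show ?thesis by simp
  qed
  finally show ?thesis .
qed

text \<open>Without a jump the deficit is 0, and one jump contributes the exact term. Two or more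
  jumps contribute at most their probability \<open>1 - (1 + x) * exp (- x)\<close>, which is at
  most \<open>x\<^sup>2\<close> for \<open>x = rate * D\<close>.\<close>

lemma expectation_deficit_square_approx:
  assumes "0 < D"
  shows "\<bar>expectation (\<lambda>\<omega>. (deficit D 0 \<omega>)\<^sup>2) - 8 / 15 * (rate * D) * exp (- rate * D)\<bar> \<le> (rate * D)\<^sup>2"
proof -
  define x where "x = rate * D"
  have x: "x > 0" using assms rate_pos by (simp add: x_def)
  have [measurable]: "deficit D 0 \<in> borel_measurable M" using assms by (intro borel_measurable_deficit) auto
  have [measurable]: "(\<lambda>\<omega>. real (N D \<omega>)) \<in> borel_measurable M" "N D \<in> measurable M (count_space UNIV)"
    using assms by (auto intro!: borel_measurable_N N_measurable)
  let ?Z = "\<lambda>\<omega>. (deficit D 0 \<omega>)\<^sup>2"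
  let ?A = "\<lambda>\<omega>. indicator {1} (real (N D \<omega>)) :: real"
  let ?B = "{\<omega> \<in> space M. N D \<omega> \<noteq> 0 \<and> N D \<omega> \<noteq> 1}"
  have Zbd: "0 \<le> ?Z \<omega>" "?Z \<omega> \<le> 1" if "\<omega> \<in> space M" for \<omega>
    using deficit_bounds[OF that, of 0 D] assms by (auto simp: abs_square_le_1)
  have int: "integrable M ?Z" "integrable M (\<lambda>\<omega>. ?Z \<omega> * ?A \<omega>)"
    using Zbd by (auto intro!: integrable_const_bound[where B = 1] simp: indicator_def)
  have eq: "expectation (\<lambda>\<omega>. ?Z \<omega> * ?A \<omega>) = 8 / 15 * x * exp (- x)"
    using expectation_deficit_square_single_jump[OF assms] by (simp add: x_def)
  have "expectation (\<lambda>\<omega>. ?Z \<omega> * ?A \<omega>) \<le> expectation ?Z"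
    using int Zbd by (intro integral_mono) (auto simp: indicator_def)
  moreover have "expectation ?Z \<le> expectation (\<lambda>\<omega>. ?Z \<omega> * ?A \<omega> + indicator ?B \<omega>)"
  proof (rule integral_mono)
    fix \<omega> assume \<omega>: "\<omega> \<in> space M"
    consider "N D \<omega> = 0" | "N D \<omega> = 1" | "\<omega> \<in> ?B" using \<omega> by blast
    then show "?Z \<omega> \<le> ?Z \<omega> * ?A \<omega> + indicator ?B \<omega>"
    proof cases
      case 1
      then have "N s \<omega> = 0" if "s \<in> {0..D}" for s using N_mono[OF \<omega>, of s D] that by auto
      then have "(LBINT s:{0..D}. (-1) ^ N s \<omega> :: real) = (LBINT s:{0..D}. 1)"
        by (intro set_lebesgue_integral_cong allI impI) auto
      also have "\<dots> = D" using assms by (simp add: set_lebesgue_integral_def)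
      finally show ?thesis using assms by (simp add: deficit_def)
    next
      case 3
      then have "?A \<omega> = 0" by (auto simp: indicator_def)
      then show ?thesis using 3 Zbd[OF \<omega>] by simp
    qed simp
  qed (use int in \<open>auto intro!: Bochner_Integration.integrable_add simp: less_top[symmetric]\<close>)
  moreover have "expectation (\<lambda>\<omega>. ?Z \<omega> * ?A \<omega> + indicator ?B \<omega>) = expectation (\<lambda>\<omega>. ?Z \<omega> * ?A \<omega>) + prob ?B"
    using int by (subst Bochner_Integration.integral_add) (auto simp: less_top[symmetric] Int_def conj_commute)
  moreover have "prob ?B \<le> x\<^sup>2"
  proof -
    have p: "prob {\<omega> \<in> space M. N D \<omega> = k} = x ^ k / fact k * exp (- x)" for k
    proof -
      have "{\<omega> \<in> space M. N D \<omega> = k} = {\<omega> \<in> space M. N D \<omega> - N 0 \<omega> = k}" using N_zero by auto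
      then show ?thesis using prob_increment[of 0 D k] assms rate_pos by (simp add: x_def)
    qed
    have "?B = space M - ({\<omega> \<in> space M. N D \<omega> = 0} \<union> {\<omega> \<in> space M. N D \<omega> = 1})" by auto
    then have "prob ?B = 1 - prob ({\<omega> \<in> space M. N D \<omega> = 0} \<union> {\<omega> \<in> space M. N D \<omega> = 1})"
      by (simp add: prob_compl)
    also have "prob ({\<omega> \<in> space M. N D \<omega> = 0} \<union> {\<omega> \<in> space M. N D \<omega> = 1}) = (1 + x) * exp (- x)"
      by (subst finite_measure_Union) (auto simp: p algebra_simps)
    also have "1 - (1 + x) * exp (- x) \<le> x\<^sup>2"
    proof -
      have "(1 + x) * (1 - x) \<le> (1 + x) * exp (- x)"
        using x exp_ge_add_one_self[of "- x"] by (intro mult_left_mono) auto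
      then show ?thesis by (simp add: algebra_simps power2_eq_square)
    qed
    finally show ?thesis .
  qed
  ultimately show ?thesis using eq unfolding x_def[symmetric] by (simp add: x_def)
qed

text \<open>After division by \<open>rate * D n\<close> the second moment tends to
  \<open>8 / 15\<close>, while the squared mean vanishes, being the mean times a convergent
  ratio.\<close>

lemma variance_deficit_over_tendsto:
  assumes D: "D \<longlonglongrightarrow> 0" "\<And>n. 0 < D n"
  shows "(\<lambda>n. expectation (\<lambda>\<omega>. (deficit (D n) 0 \<omega> - mean_deficit (rate * D n))\<^sup>2) / (8 / 15 * rate * D n)) \<longlonglongrightarrow> 1"
proof -
  define x where "x n = rate * D n" for n
  have x: "x n > 0" for n using D(2) rate_pos by (simp add: x_def)
  have x0: "x \<longlonglongrightarrow> 0" unfolding x_def[abs_def] using D(1) by (rule tendsto_mult_right_zero)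
  then have xr: "filterlim x (at_right 0) sequentially" using x by (auto simp: filterlim_at less_imp_neq[symmetric])
  define q where "q n = expectation (\<lambda>\<omega>. (deficit (D n) 0 \<omega>)\<^sup>2)" for n
  have var: "expectation (\<lambda>\<omega>. (deficit (D n) 0 \<omega> - mean_deficit (rate * D n))\<^sup>2) = q n - (mean_deficit (x n))\<^sup>2" for n
  proof -
    have [measurable]: "deficit (D n) 0 \<in> borel_measurable M" using D(2) by (intro borel_measurable_deficit) auto
    have bd: "0 \<le> deficit (D n) 0 \<omega>" "deficit (D n) 0 \<omega> \<le> 1" if "\<omega> \<in> space M" for \<omega>
      using deficit_bounds[OF that, of 0 "D n"] D(2) by auto
    have int: "integrable M (deficit (D n) 0)" "integrable M (\<lambda>\<omega>. (deficit (D n) 0 \<omega>)\<^sup>2)"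
      using bd by (auto intro!: integrable_const_bound[where B = 1] simp: abs_square_le_1)
    show ?thesis
      using variance_eq[OF int] expectation_deficit[OF D(2), of n] by (simp add: q_def x_def)
  qed
  have t1: "(\<lambda>n. (q n - 8 / 15 * x n * exp (- x n)) / x n) \<longlonglongrightarrow> 0"
  proof (rule Lim_null_comparison[OF always_eventually x0], rule allI)
    fix n
    have "\<bar>q n - 8 / 15 * x n * exp (- x n)\<bar> \<le> (x n)\<^sup>2"
      using expectation_deficit_square_approx[OF D(2), of n] by (simp add: q_def x_def)
    then show "norm ((q n - 8 / 15 * x n * exp (- x n)) / x n) \<le> x n"
      using x[of n] by (simp add: divide_le_eq power2_eq_square)
  qed
  have t2: "(\<lambda>n. mean_deficit (x n) * (mean_deficit (x n) / x n)) \<longlonglongrightarrow> 0 * (2 / 3)"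
    by (intro tendsto_mult filterlim_compose[OF mean_deficit_tendsto_0 xr]
        filterlim_compose[OF mean_deficit_over_x xr])
  have lim: "(\<lambda>n. ((q n - 8 / 15 * x n * exp (- x n)) / x n + 8 / 15 * exp (- x n)
      - mean_deficit (x n) * (mean_deficit (x n) / x n)) / (8 / 15)) \<longlonglongrightarrow>
      (0 + 8 / 15 * exp (- 0) - 0 * (2 / 3)) / (8 / 15)"
    by (intro tendsto_divide tendsto_diff tendsto_add t1 t2 tendsto_mult[OF tendsto_const]
        tendsto_exp tendsto_minus x0 tendsto_const) simp
  have eq: "((q n - 8 / 15 * x n * exp (- x n)) / x n + 8 / 15 * exp (- x n)
      - mean_deficit (x n) * (mean_deficit (x n) / x n)) / (8 / 15)
    = (q n - (mean_deficit (x n))\<^sup>2) / (8 / 15 * rate * D n)" for n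
  proof -
    have "8 / 15 * rate * D n = 8 / 15 * x n" by (simp add: x_def)
    then show ?thesis using x[of n] by (simp add: field_simps power2_eq_square)
  qed
  show ?thesis using lim[unfolded eq] unfolding var by simp
qed

end

section \<open>Asymptotic normality\<close>

lemma (in prob_space) char_distr_affine:
  assumes [measurable]: "T \<in> borel_measurable M"
  shows "char (distr M borel (\<lambda>\<omega>. (T \<omega> - c) / r)) t = iexp (- (t / r) * c) * char (distr M borel T) (t / r)"
proof -
  have "char (distr M borel (\<lambda>\<omega>. (T \<omega> - c) / r)) t = (CLINT \<omega>|M. iexp (t * ((T \<omega> - c) / r)))"
    by (simp add: char_def integral_distr)
  also have "\<dots> = (CLINT \<omega>|M. iexp (- (t / r) * c) * iexp (t / r * T \<omega>))"
  proof (rule Bochner_Integration.integral_cong[OF refl])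
    fix \<omega>
    have "t * ((T \<omega> - c) / r) = - (t / r) * c + t / r * T \<omega>"
      by (simp add: diff_divide_distrib algebra_simps)
    then show "iexp (t * ((T \<omega> - c) / r)) = iexp (- (t / r) * c) * iexp (t / r * T \<omega>)"
      by (simp only: of_real_add distrib_left exp_add)
  qed
  also have "\<dots> = iexp (- (t / r) * c) * char (distr M borel T) (t / r)"
    by (simp add: char_def integral_distr)
  finally show ?thesis .
qed

text \<open>Rewrites a threshold of the normalised sum as \<open>sqrt (n * D)\<close> times a
  difference quotient of order \<open>1 / D\<close>, the form in which its limit can be read
  off.\<close>

lemma mult_divide_sqrt_mult:
  fixes a c d z :: real
  assumes "0 < a" "0 < c" "0 < d"
  shows "a * z / sqrt (a * (c * d)) = sqrt (a * d) * (z / d) / sqrt c"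
proof -
  define s where "s = sqrt (a * d)"
  have "sqrt (a * (c * d)) = s * sqrt c" by (simp add: s_def mult_ac flip: real_sqrt_mult)
  moreover have "s * s = a * d" "s > 0" using assms by (simp_all add: s_def)
  then have "a = s * s / d" using assms by simp
  ultimately show ?thesis
    using \<open>s > 0\<close> unfolding s_def[symmetric] by simp
qed

lemma (in prob_space) abs_prob_diff_le:
  assumes "A \<in> events" "B \<in> events" "C \<in> events" "A \<subseteq> B \<union> C" "B \<subseteq> A \<union> C"
  shows "\<bar>prob A - prob B\<bar> \<le> prob C"
proof -
  have "prob A \<le> prob (B \<union> C)" "prob B \<le> prob (A \<union> C)"
    using assms by (auto intro!: finite_measure_mono)
  moreover have "prob (B \<union> C) \<le> prob B + prob C" "prob (A \<union> C) \<le> prob A + prob C"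
    using assms by (auto intro!: measure_Un_le)
  ultimately show ?thesis by linarith
qed

text \<open>A deviation beyond \<open>\<epsilon>\<close> is a deviation of the scaled error beyond
  \<open>r n * \<epsilon>\<close>; this bound tends to infinity, so both tails vanish.\<close>

lemma (in prob_space) consistent_estimator_of_weak_conv:
  assumes T [measurable]: "\<And>n. T n \<in> borel_measurable M"
    and wc: "weak_conv_m (\<lambda>n. distr M borel (\<lambda>\<omega>. r n * (T n \<omega> - \<theta>))) \<nu>"
    and \<nu>: "real_distribution \<nu>" "\<And>x. isCont (cdf \<nu>) x" and r: "filterlim r at_top sequentially"
  shows "consistent_estimator M T \<theta>"
  unfolding consistent_estimator_def
proof (intro allI impI)
  fix \<epsilon> :: real assume "\<epsilon> > 0"
  define \<mu> where "\<mu> n = distr M borel (\<lambda>\<omega>. r n * (T n \<omega> - \<theta>))" for n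
  have \<mu>: "real_distribution (\<mu> n)" for n unfolding \<mu>_def by (rule real_distribution_distr) simp
  have cdf: "cdf (\<mu> n) x = prob {\<omega> \<in> space M. r n * (T n \<omega> - \<theta>) \<le> x}" for n x
    unfolding \<mu>_def cdf_def by (subst measure_distr) (auto intro!: arg_cong[where f = prob])
  have r\<epsilon>: "filterlim (\<lambda>n. r n * \<epsilon>) at_top sequentially"
    using \<open>\<epsilon> > 0\<close> r by (intro filterlim_at_top_mult_tendsto_pos[OF tendsto_const])
  note lims = weak_conv_m_cdf_at_top[OF wc[folded \<mu>_def] \<mu> \<nu> r\<epsilon>]
    weak_conv_m_cdf_at_bot[OF wc[folded \<mu>_def] \<mu> \<nu>, of "\<lambda>n. - (r n * \<epsilon>)"]
  have lim: "(\<lambda>n. (1 - cdf (\<mu> n) (r n * \<epsilon>)) + cdf (\<mu> n) (- (r n * \<epsilon>))) \<longlonglongrightarrow> (1 - 1) + 0"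
    using r\<epsilon> by (intro tendsto_intros lims) (simp add: filterlim_uminus_at_bot)
  show "(\<lambda>n. prob {\<omega> \<in> space M. \<bar>T n \<omega> - \<theta>\<bar> > \<epsilon>}) \<longlonglongrightarrow> 0"
  proof (rule tendsto_sandwich[OF _ _ tendsto_const])
    show "(\<lambda>n. (1 - cdf (\<mu> n) (r n * \<epsilon>)) + cdf (\<mu> n) (- (r n * \<epsilon>))) \<longlonglongrightarrow> 0"
      using lim by simp
    have "eventually (\<lambda>n. r n > 0) sequentially" using r by (simp add: filterlim_at_top_dense)
    then show "eventually (\<lambda>n. prob {\<omega> \<in> space M. \<bar>T n \<omega> - \<theta>\<bar> > \<epsilon>}
      \<le> (1 - cdf (\<mu> n) (r n * \<epsilon>)) + cdf (\<mu> n) (- (r n * \<epsilon>))) sequentially"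
    proof eventually_elim
      case (elim n)
      let ?A = "{\<omega> \<in> space M. r n * (T n \<omega> - \<theta>) \<le> r n * \<epsilon>}"
      let ?B = "{\<omega> \<in> space M. r n * (T n \<omega> - \<theta>) \<le> - (r n * \<epsilon>)}"
      have "prob {\<omega> \<in> space M. \<bar>T n \<omega> - \<theta>\<bar> > \<epsilon>} \<le> prob ((space M - ?A) \<union> ?B)"
      proof (intro finite_measure_mono subsetI)
        fix \<omega> assume *: "\<omega> \<in> {\<omega> \<in> space M. \<bar>T n \<omega> - \<theta>\<bar> > \<epsilon>}"
        then consider "T n \<omega> - \<theta> > \<epsilon>" | "T n \<omega> - \<theta> \<le> - \<epsilon>" by fastforce
        then show "\<omega> \<in> (space M - ?A) \<union> ?B"
        proof cases
          case 1
          then show ?thesis using * mult_strict_left_mono[OF 1 elim] by auto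
        next
          case 2
          then show ?thesis using * mult_left_mono[OF 2, of "r n"] elim by auto
        qed
      qed measurable
      also have "\<dots> \<le> prob (space M - ?A) + prob ?B"
        by (rule measure_Un_le) measurable
      also have "prob (space M - ?A) = 1 - prob ?A" by (rule prob_compl) measurable
      finally show ?case unfolding cdf .
    qed
  qed simp
qed

context poisson_process
begin

text \<open>The factor \<open>8 / 15\<close> is \<open>\<integral> (1 - (2 * u - 1)\<^sup>2)\<^sup>2 du\<close> over \<open>[0, 1]\<close>.\<close>

definition scaled_deficit_sum :: "(nat \<Rightarrow> real) \<Rightarrow> nat \<Rightarrow> 'a \<Rightarrow> real" where
  "scaled_deficit_sum D n \<omega> = ((\<Sum>i<n. deficit (D n) (real i * D n) \<omega>) - real n * mean_deficit (rate * D n))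
    / sqrt (real n * (8 / 15 * rate * D n))"

lemma borel_measurable_sum_deficit:
  assumes "0 < d"
  shows "(\<lambda>\<omega>. \<Sum>i<n. deficit d (real i * d) \<omega>) \<in> borel_measurable M"
  using assms by (intro borel_measurable_sum borel_measurable_deficit) auto

lemma borel_measurable_scaled_deficit_sum:
  assumes "0 < D n"
  shows "scaled_deficit_sum D n \<in> borel_measurable M"
  unfolding scaled_deficit_sum_def[abs_def]
  using borel_measurable_sum_deficit[OF assms, of n] by measurable

text \<open>It is the expectation of a variable with values in \<open>[0, 1]\<close>.\<close>

lemma mean_deficit_bounds:
  assumes "0 < D"
  shows "0 \<le> mean_deficit (rate * D)" "mean_deficit (rate * D) \<le> 1"
proof -
  have [measurable]: "deficit D 0 \<in> borel_measurable M" using assms by (intro borel_measurable_deficit) auto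
  have "integrable M (deficit D 0)"
    using deficit_bounds[of _ 0 D] assms by (auto intro!: integrable_const_bound[where B = 1])
  then show "0 \<le> mean_deficit (rate * D)" "mean_deficit (rate * D) \<le> 1"
    using deficit_bounds[of _ 0 D] assms unfolding expectation_deficit[OF assms, symmetric]
    by (auto intro!: integral_ge_const integral_le_const)
qed

lemma scaled_deficit_sum_weak_conv:
  assumes D: "D \<longlonglongrightarrow> 0" "\<And>n. 0 < D n" and nD: "filterlim (\<lambda>n. real n * D n) at_top sequentially"
  shows "weak_conv_m (\<lambda>n. distr M borel (scaled_deficit_sum D n)) std_normal_distribution"
proof (rule levy_continuity)
  show "real_distribution (distr M borel (scaled_deficit_sum D n))" for n
    using D(2) by (intro real_distribution_distr borel_measurable_scaled_deficit_sum)
  show "real_distribution std_normal_distribution" by (rule real_dist_normal_dist)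
  fix t
  define d where "d n = 8 / 15 * rate * D n" for n
  define m where "m n = mean_deficit (rate * D n)" for n
  define W where "W n \<omega> = deficit (D n) 0 \<omega> - m n" for n \<omega>
  have [measurable]: "deficit (D n) 0 \<in> borel_measurable M" for n
    using D(2) by (intro borel_measurable_deficit) auto
  have "(\<lambda>n. char (distr M borel (W n)) (t / sqrt (real n * d n)) ^ n) \<longlonglongrightarrow> char std_normal_distribution t"
  proof (rule char_power_tendsto_normal)
    show "random_variable borel (W n)" for n unfolding W_def[abs_def] by measurable
    show "\<bar>W n \<omega>\<bar> \<le> 1" if "\<omega> \<in> space M" for n \<omega>
      using deficit_bounds[OF that, of 0 "D n"] mean_deficit_bounds[OF D(2), of n] D(2)[of n]
      by (simp add: W_def m_def abs_le_iff)
    have "integrable M (deficit (D n) 0)" for n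
      using deficit_bounds[of _ 0 "D n"] D(2) by (auto intro!: integrable_const_bound[where B = 1])
    then show "expectation (W n) = 0" for n
      by (simp add: W_def[abs_def] m_def expectation_deficit D(2) prob_space)
    show "(\<lambda>n. expectation (\<lambda>\<omega>. (W n \<omega>)\<^sup>2) / d n) \<longlonglongrightarrow> 1"
      using variance_deficit_over_tendsto[OF D] by (simp add: W_def m_def d_def)
    have "filterlim (\<lambda>n. (8 / 15 * rate) * (real n * D n)) at_top sequentially"
      using rate_pos by (intro filterlim_tendsto_pos_mult_at_top[OF tendsto_const] nD) auto
    then show "filterlim (\<lambda>n. real n * d n) at_top sequentially"
      by (simp add: d_def mult_ac)
  qed
  moreover have "char (distr M borel (scaled_deficit_sum D n)) t
    = char (distr M borel (W n)) (t / sqrt (real n * d n)) ^ n" for n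
  proof -
    define u where "u = t / sqrt (real n * d n)"
    have "char (distr M borel (scaled_deficit_sum D n)) t
      = iexp (- u * (real n * m n)) * char (distr M borel (deficit (D n) 0)) u ^ n"
      unfolding scaled_deficit_sum_def[abs_def] m_def[symmetric] d_def[symmetric]
      by (subst char_distr_affine)
         (auto simp: u_def char_sum_deficit D(2) intro!: borel_measurable_sum_deficit)
    \<comment> \<open>The phase from centring the sum is distributed over the \<open>n\<close>
      factors, each of which becomes the characteristic function of \<open>W n\<close>.\<close>
    also have "iexp (- u * (real n * m n)) = iexp (- u * m n) ^ n"
      by (simp add: mult_ac flip: exp_of_nat_mult)
    also have "iexp (- u * m n) ^ n * char (distr M borel (deficit (D n) 0)) u ^ n = char (distr M borel (W n)) u ^ n"
      using char_distr_affine[of "deficit (D n) 0" "m n" 1 u] by (simp add: W_def[abs_def] power_mult_distrib)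
    finally show ?thesis by (simp add: u_def)
  qed
  ultimately show "(\<lambda>n. char (distr M borel (scaled_deficit_sum D n)) t) \<longlonglongrightarrow> char std_normal_distribution t"
    by simp
qed

definition mean_sample_deficit :: "(nat \<Rightarrow> real) \<Rightarrow> nat \<Rightarrow> 'a \<Rightarrow> real" where
  "mean_sample_deficit D n \<omega> = (\<Sum>i<n. deficit (D n) (real i * D n) \<omega>) / real n"

lemma mean_sample_deficit_le_iff:
  assumes "0 < D n" "1 \<le> n"
  shows "mean_sample_deficit D n \<omega> \<le> z \<longleftrightarrow> scaled_deficit_sum D n \<omega>
    \<le> real n * (z - mean_deficit (rate * D n)) / sqrt (real n * (8 / 15 * rate * D n))"
proof -
  have "sqrt (real n * (8 / 15 * rate * D n)) > 0" "real n > 0" using assms rate_pos by auto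
  then show ?thesis
    unfolding scaled_deficit_sum_def mean_sample_deficit_def
    by (simp add: divide_le_cancel pos_divide_le_eq algebra_simps)
qed

text \<open>In the scale of the normalised sum the levels 0 and 1 of the sample mean become
  thresholds that run off to minus and plus infinity, so the normal limit leaves no mass beyond
  them.\<close>

lemma degenerate_mean_prob_tendsto:
  assumes D: "D \<longlonglongrightarrow> 0" "\<And>n. 0 < D n" and nD: "filterlim (\<lambda>n. real n * D n) at_top sequentially"
  shows "(\<lambda>n. prob {\<omega> \<in> space M. mean_sample_deficit D n \<omega> \<le> 0 \<or> 1 \<le> mean_sample_deficit D n \<omega>}) \<longlonglongrightarrow> 0"
proof -
  define k where "k = sqrt (8 / 15 * rate)"
  have k: "k > 0" using rate_pos by (simp add: k_def)
  define r where "r n = sqrt (real n * D n)" for n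
  have r: "filterlim r at_top sequentially"
    unfolding r_def by (rule filterlim_compose[OF sqrt_at_top nD])
  define m where "m n = mean_deficit (rate * D n)" for n
  define \<mu> where "\<mu> n = distr M borel (scaled_deficit_sum D n)" for n
  define b where "b n z = real n * (z - m n) / sqrt (real n * (8 / 15 * rate * D n))" for n z
  have b_eq: "b n z = r n * ((z - m n) / D n) / k" if "n \<ge> 1" for n z
    using mult_divide_sqrt_mult[of "real n" "8 / 15 * rate" "D n"] that D(2)[of n] rate_pos
    by (simp add: b_def r_def k_def)
  have [measurable]: "scaled_deficit_sum D n \<in> borel_measurable M" for n
    using D(2) by (rule borel_measurable_scaled_deficit_sum)
  have [measurable]: "mean_sample_deficit D n \<in> borel_measurable M" for n
    unfolding mean_sample_deficit_def[abs_def] using borel_measurable_sum_deficit[OF D(2)] by measurable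
  have \<mu>: "real_distribution (\<mu> n)" for n unfolding \<mu>_def by (rule real_distribution_distr) simp
  have cdf: "cdf (\<mu> n) x = prob {\<omega> \<in> space M. scaled_deficit_sum D n \<omega> \<le> x}" for n x
    unfolding \<mu>_def cdf_def by (subst measure_distr) (auto intro!: arg_cong[where f = prob])
  have wc: "weak_conv_m \<mu> std_normal_distribution"
    unfolding \<mu>_def by (rule scaled_deficit_sum_weak_conv[OF D nD])
  have cont: "isCont (cdf std_normal_distribution) x" for x by (rule isCont_cdf_normal) simp
  have Dr: "filterlim (\<lambda>n. rate * D n) (at_right 0) sequentially"
    using D rate_pos by (auto simp: filterlim_at less_imp_neq[symmetric] intro!: tendsto_mult_right_zero)
  have "filterlim (\<lambda>n. b n 0) at_bot sequentially"
  proof -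
    \<comment> \<open>Expanding by \<open>rate\<close> puts \<open>m n / D n\<close> into the form
      of the limit \<open>mean_deficit x / x\<close>.\<close>
    have "(\<lambda>n. rate * (m n / (rate * D n)) / k) \<longlonglongrightarrow> rate * (2 / 3) / k"
      unfolding m_def using k
      by (intro tendsto_divide tendsto_const
          tendsto_mult[OF tendsto_const filterlim_compose[OF mean_deficit_over_x Dr]]) auto
    from filterlim_tendsto_pos_mult_at_top[OF this _ r]
    have "filterlim (\<lambda>n. (rate * (m n / (rate * D n)) / k) * r n) at_top sequentially"
      using k rate_pos by simp
    then have "filterlim (\<lambda>n. - ((rate * (m n / (rate * D n)) / k) * r n)) at_bot sequentially"
      by (simp add: filterlim_uminus_at_bot)
    then show ?thesis
    proof (rule filterlim_mono_eventually[OF _ order_refl order_refl])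
      show "eventually (\<lambda>n. - ((rate * (m n / (rate * D n)) / k) * r n) = b n 0) sequentially"
        using eventually_ge_at_top[of 1]
        by eventually_elim (use rate_pos in \<open>simp add: b_eq mult_ac\<close>)
    qed
  qed
  then have lo: "(\<lambda>n. cdf (\<mu> n) (b n 0)) \<longlonglongrightarrow> 0"
    by (rule weak_conv_m_cdf_at_bot[OF wc \<mu> real_dist_normal_dist cont])
  \<comment> \<open>The shift by -1 is for the boundary case: a mean equal to 1 gives a normalised
    sum equal to \<open>b n 1\<close>, which the complement of \<open>{S \<le> b n 1}\<close> would
    miss.\<close>
  have "filterlim (\<lambda>n. - 1 + b n 1) at_top sequentially"
  proof (rule filterlim_tendsto_add_at_top[OF tendsto_const])
    have "m \<longlonglongrightarrow> 0" unfolding m_def by (rule filterlim_compose[OF mean_deficit_tendsto_0 Dr])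
    then have "(\<lambda>n. (1 - m n) / k) \<longlonglongrightarrow> (1 - 0) / k" using k by (intro tendsto_intros) auto
    from filterlim_tendsto_pos_mult_at_top[OF this _ r]
    have "filterlim (\<lambda>n. (1 - m n) / k * r n) at_top sequentially"
      using k by simp
    \<comment> \<open>Once \<open>D n < 1\<close>, omitting the division by \<open>D n\<close> can
      only lower the nonnegative threshold.\<close>
    moreover have "eventually (\<lambda>n. (1 - m n) / k * r n \<le> b n 1) sequentially"
      using eventually_ge_at_top[of 1] order_tendstoD(2)[OF D(1), of 1, simplified]
    proof eventually_elim
      case (elim n)
      have "(1 - m n) * D n \<le> (1 - m n) * 1"
        using elim mean_deficit_bounds[OF D(2), of n] by (intro mult_left_mono) (auto simp: m_def)
      then have "1 - m n \<le> (1 - m n) / D n" using D(2)[of n] by (simp add: field_simps)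
      moreover have "0 \<le> r n" using D(2)[of n] by (simp add: r_def)
      ultimately have "r n * (1 - m n) / k \<le> r n * ((1 - m n) / D n) / k"
        using k by (intro divide_right_mono mult_left_mono) auto
      then show ?case using elim by (simp add: b_eq mult.commute)
    qed
    ultimately show "filterlim (\<lambda>n. b n 1) at_top sequentially" by (rule filterlim_at_top_mono)
  qed
  then have hi: "(\<lambda>n. cdf (\<mu> n) (- 1 + b n 1)) \<longlonglongrightarrow> 1"
    by (rule weak_conv_m_cdf_at_top[OF wc \<mu> real_dist_normal_dist cont])
  have lim: "(\<lambda>n. cdf (\<mu> n) (b n 0) + (1 - cdf (\<mu> n) (- 1 + b n 1))) \<longlonglongrightarrow> 0 + (1 - 1)"
    by (intro tendsto_intros lo hi)
  show ?thesis
  proof (rule tendsto_sandwich[OF _ _ tendsto_const])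
    show "(\<lambda>n. cdf (\<mu> n) (b n 0) + (1 - cdf (\<mu> n) (- 1 + b n 1))) \<longlonglongrightarrow> 0" using lim by simp
    show "eventually (\<lambda>n. prob {\<omega> \<in> space M. mean_sample_deficit D n \<omega> \<le> 0 \<or> 1 \<le> mean_sample_deficit D n \<omega>}
      \<le> cdf (\<mu> n) (b n 0) + (1 - cdf (\<mu> n) (- 1 + b n 1))) sequentially"
      using eventually_ge_at_top[of 1]
    proof eventually_elim
      case (elim n)
      let ?S = "scaled_deficit_sum D n"
      let ?A = "{\<omega> \<in> space M. ?S \<omega> \<le> b n 0}" and ?B = "{\<omega> \<in> space M. ?S \<omega> \<le> - 1 + b n 1}"
      have le: "mean_sample_deficit D n \<omega> \<le> z \<longleftrightarrow> ?S \<omega> \<le> b n z" for \<omega> z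
        unfolding b_def m_def using D(2) elim by (rule mean_sample_deficit_le_iff)
      have "prob {\<omega> \<in> space M. mean_sample_deficit D n \<omega> \<le> 0 \<or> 1 \<le> mean_sample_deficit D n \<omega>}
        \<le> prob (?A \<union> (space M - ?B))"
      proof (intro finite_measure_mono subsetI)
        fix \<omega> assume *: "\<omega> \<in> {\<omega> \<in> space M. mean_sample_deficit D n \<omega> \<le> 0 \<or> 1 \<le> mean_sample_deficit D n \<omega>}"
        then consider "mean_sample_deficit D n \<omega> \<le> 0" | "1 \<le> mean_sample_deficit D n \<omega>" by auto
        then show "\<omega> \<in> ?A \<union> (space M - ?B)"
        proof cases
          case 1
          then show ?thesis using * le[of \<omega> 0] by simp
        next
          case 2
          define z where "z = mean_sample_deficit D n \<omega>"
          have "real n * (z - m n) = (\<Sum>i<n. deficit (D n) (real i * D n) \<omega>) - real n * m n"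
            using elim by (simp add: z_def mean_sample_deficit_def algebra_simps)
          then have "?S \<omega> = b n z" by (simp add: b_def scaled_deficit_sum_def m_def)
          also have "b n z \<ge> b n 1"
            using 2 D(2)[of n] rate_pos unfolding b_def z_def[symmetric]
            by (intro divide_right_mono mult_left_mono) auto
          finally show ?thesis using * by simp
        qed
      qed measurable
      also have "\<dots> \<le> prob ?A + prob (space M - ?B)"
        by (rule measure_Un_le) measurable
      also have "prob (space M - ?B) = 1 - prob ?B" by (rule prob_compl) measurable
      finally show ?case unfolding cdf .
    qed
  qed simp
qed

end

section \<open>From the sample mean to the estimator\<close>

context telegraph_process
begin

lemma V0_square_prob: "prob {\<omega> \<in> space M. (V0 \<omega>)\<^sup>2 \<noteq> v\<^sup>2} = 0"
proof -
  note [measurable] = V0_measurable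
  let ?A = "{\<omega> \<in> space M. V0 \<omega> = v}" and ?B = "{\<omega> \<in> space M. V0 \<omega> = - v}"
  have "prob (?A \<union> ?B) = prob ?A + prob ?B"
    using v_pos by (intro finite_measure_Union) auto
  then have "prob (?A \<union> ?B) = 1" using V0_plus V0_minus by simp
  moreover have "{\<omega> \<in> space M. (V0 \<omega>)\<^sup>2 \<noteq> v\<^sup>2} = space M - (?A \<union> ?B)"
    by (auto simp: power2_eq_iff)
  ultimately show ?thesis by (simp add: prob_compl)
qed

text \<open>\<open>V0\<close> factors out of every increment, and its square cancels against
  \<open>v\<^sup>2\<close>.\<close>

lemma mean_square_increment:
  assumes \<omega>: "\<omega> \<in> space M" "(V0 \<omega>)\<^sup>2 = v\<^sup>2" and D: "0 < D n" "1 \<le> n"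
  shows "1 - (\<Sum>i=1..n. ((X (real i * D n) \<omega> - X ((real i - 1) * D n) \<omega>) / (v * D n))\<^sup>2) / real n
    = mean_sample_deficit D n \<omega>"
proof -
  \<comment> \<open>The sum over \<open>1..n\<close> is reindexed from 0, so increment
    \<open>Suc i\<close> belongs to the block starting at \<open>real i * D n\<close>.\<close>
  have "((X (real (Suc i) * D n) \<omega> - X ((real (Suc i) - 1) * D n) \<omega>) / (v * D n))\<^sup>2
      = 1 - deficit (D n) (real i * D n) \<omega>" for i
  proof -
    have "X (real (Suc i) * D n) \<omega> - X ((real (Suc i) - 1) * D n) \<omega>
      = V0 \<omega> * ((LBINT s:{0..real i * D n + D n}. (-1) ^ N s \<omega>) - (LBINT s:{0..real i * D n}. (-1) ^ N s \<omega>))"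
      using D X_eq[OF _ \<omega>(1)] by (simp add: algebra_simps)
    also have "\<dots> = V0 \<omega> * (LBINT s:{real i * D n..real i * D n + D n}. (-1) ^ N s \<omega>)"
      using D \<omega>(1) by (subst path_integral_shift) auto
    finally show ?thesis
      using \<omega>(2) v_pos by (simp add: deficit_def power_divide power_mult_distrib)
  qed
  then have "(\<Sum>i=1..n. ((X (real i * D n) \<omega> - X ((real i - 1) * D n) \<omega>) / (v * D n))\<^sup>2)
      = (\<Sum>i<n. 1 - deficit (D n) (real i * D n) \<omega>)"
    by (simp only: One_nat_def sum.atLeast1_atMost_eq)
  also have "\<dots> = real n - (\<Sum>i<n. deficit (D n) (real i * D n) \<omega>)"
    by (simp add: sum_subtractf)
  finally show ?thesis using D by (simp add: mean_sample_deficit_def diff_divide_distrib)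
qed

text \<open>A mean strictly between 0 and 1 guarantees a positive root, so the estimator is one, and
  strict monotonicity of \<open>mean_deficit\<close> carries the inequality across.\<close>

lemma estimator_le_iff:
  assumes est: "moment_type_estimator M v (D n) n
      (\<lambda>i \<omega>. X (real i * D n) \<omega> - X ((real i - 1) * D n) \<omega>) est"
    and \<omega>: "\<omega> \<in> space M" "(V0 \<omega>)\<^sup>2 = v\<^sup>2" and D: "0 < D n" "1 \<le> n" and "0 < y"
    and z: "0 < mean_sample_deficit D n \<omega>" "mean_sample_deficit D n \<omega> < 1"
  shows "est \<omega> \<le> y \<longleftrightarrow> mean_sample_deficit D n \<omega> \<le> mean_deficit (y * D n)"
proof -
  have iff: "moment_equation v (D n) n (\<lambda>i. X (real i * D n) \<omega> - X ((real i - 1) * D n) \<omega>) l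
      \<longleftrightarrow> mean_sample_deficit D n \<omega> = mean_deficit (l * D n)" if "l > 0" for l
    using moment_equation_iff[OF v_pos D(1) that D(2)] mean_square_increment[where D = D, OF \<omega> D] by simp
  obtain x where x: "x > 0" "mean_deficit x = mean_sample_deficit D n \<omega>"
    using mean_deficit_surj[OF z] by metis
  then have "\<exists>l>0. moment_equation v (D n) n (\<lambda>i. X (real i * D n) \<omega> - X ((real i - 1) * D n) \<omega>) l"
    using iff[of "x / D n"] D by (intro exI[of _ "x / D n"]) simp
  then have "est \<omega> > 0" "mean_sample_deficit D n \<omega> = mean_deficit (est \<omega> * D n)"
    using est \<omega>(1) iff unfolding moment_type_estimator_def by auto
  then show ?thesis using D \<open>0 < y\<close> by (simp add: mean_deficit_le_iff)
qed

lemma estimator_weak_conv: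
  assumes D: "D \<longlonglongrightarrow> 0" "\<And>n. 0 < D n" and nD: "filterlim (\<lambda>n. real n * D n) at_top sequentially"
    and est: "\<And>n. n \<ge> 1 \<Longrightarrow> moment_type_estimator M v (D n) n
      (\<lambda>i \<omega>. X (real i * D n) \<omega> - X ((real i - 1) * D n) \<omega>) (est n)"
    and est_measurable: "\<And>n. est n \<in> borel_measurable M"
  shows "weak_conv_m (\<lambda>n. distr M borel (\<lambda>\<omega>. sqrt (real n * D n) * (est n \<omega> - rate)))
      (density lborel (normal_density 0 (sqrt (6 / 5 * rate))))"
  unfolding weak_conv_m_def weak_conv_def
proof (intro allI impI)
  fix x :: real
  note [measurable] = est_measurable V0_measurable
  define k where "k = sqrt (8 / 15 * rate)"
  have k: "k > 0" using rate_pos by (simp add: k_def)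
  define r where "r n = sqrt (real n * D n)" for n
  have r: "filterlim r at_top sequentially"
    unfolding r_def by (rule filterlim_compose[OF sqrt_at_top nD])
  define y where "y n = rate + x / r n" for n
  define b where "b n = real n * (mean_deficit (y n * D n) - mean_deficit (rate * D n))
      / sqrt (real n * (8 / 15 * rate * D n))" for n
  define \<mu> where "\<mu> n = distr M borel (scaled_deficit_sum D n)" for n
  define F where "F n = cdf (distr M borel (\<lambda>\<omega>. r n * (est n \<omega> - rate))) x" for n
  define bad where "bad n = {\<omega> \<in> space M. mean_sample_deficit D n \<omega> \<le> 0 \<or> 1 \<le> mean_sample_deficit D n \<omega>}" for n
  define V where "V = {\<omega> \<in> space M. (V0 \<omega>)\<^sup>2 \<noteq> v\<^sup>2}"
  have [measurable]: "scaled_deficit_sum D n \<in> borel_measurable M" for n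
    using D(2) by (rule borel_measurable_scaled_deficit_sum)
  have [measurable]: "mean_sample_deficit D n \<in> borel_measurable M" for n
    unfolding mean_sample_deficit_def[abs_def] using borel_measurable_sum_deficit[OF D(2)] by measurable
  have [measurable]: "bad n \<in> events" "V \<in> events" for n unfolding bad_def V_def by measurable
  have \<mu>: "real_distribution (\<mu> n)" for n unfolding \<mu>_def by (rule real_distribution_distr) simp
  have cdf: "cdf (\<mu> n) x = prob {\<omega> \<in> space M. scaled_deficit_sum D n \<omega> \<le> x}" for n x
    unfolding \<mu>_def cdf_def by (subst measure_distr) (auto intro!: arg_cong[where f = prob])
  have F: "F n = prob {\<omega> \<in> space M. r n * (est n \<omega> - rate) \<le> x}" for n
    unfolding F_def cdf_def by (subst measure_distr) (auto intro!: arg_cong[where f = prob])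
  have b_eq: "b n = r n * (mean_deficit (y n * D n) - mean_deficit (rate * D n)) / D n / k" if "n \<ge> 1" for n
    using mult_divide_sqrt_mult[of "real n" "8 / 15 * rate" "D n"] that D(2)[of n] rate_pos
    by (simp add: b_def r_def k_def)
  have "(\<lambda>n. r n * (mean_deficit (y n * D n) - mean_deficit (rate * D n)) / D n / k) \<longlonglongrightarrow> 2 / 3 * x / k"
    unfolding y_def using D k rate_pos
    by (intro tendsto_divide mean_deficit_increment tendsto_const r) auto
  then have "b \<longlonglongrightarrow> 2 / 3 * x / k"
    by (rule Lim_transform_eventually)
       (use eventually_ge_at_top[of 1] in \<open>eventually_elim, simp add: b_eq\<close>)
  then have "(\<lambda>n. cdf (\<mu> n) (b n)) \<longlonglongrightarrow> cdf std_normal_distribution (2 / 3 * x / k)"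
    using scaled_deficit_sum_weak_conv[OF D nD] unfolding \<mu>_def[symmetric]
    by (intro weak_conv_m_cdf_tendsto[OF _ \<mu>] isCont_cdf_normal) auto
  \<comment> \<open>The two events agree off \<open>bad n\<close> and the null set \<open>V\<close>,
    so their probabilities differ by at most \<open>prob (bad n)\<close>, whatever the estimator
    does there.\<close>
  moreover have "(\<lambda>n. F n - cdf (\<mu> n) (b n)) \<longlonglongrightarrow> 0"
  proof (rule Lim_null_comparison)
    show "(\<lambda>n. prob (bad n)) \<longlonglongrightarrow> 0"
      unfolding bad_def by (rule degenerate_mean_prob_tendsto[OF D nD])
    have "(\<lambda>n. x / r n) \<longlonglongrightarrow> 0"
      using r by (intro tendsto_divide_0[OF tendsto_const] filterlim_at_top_imp_at_infinity)
    then have "y \<longlonglongrightarrow> rate + 0" unfolding y_def by (intro tendsto_intros)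
    \<comment> \<open>For negative \<open>x\<close> the threshold can be negative at small
      \<open>n\<close>, whereas the comparison through \<open>mean_deficit\<close> requires a
      positive argument.\<close>
    then have "eventually (\<lambda>n. y n > 0) sequentially" using rate_pos by (intro order_tendstoD(1)) auto
    moreover have "eventually (\<lambda>n. r n > 0) sequentially" using r by (simp add: filterlim_at_top_dense)
    ultimately show "eventually (\<lambda>n. norm (F n - cdf (\<mu> n) (b n)) \<le> prob (bad n)) sequentially"
      using eventually_ge_at_top[of 1]
    proof eventually_elim
      case (elim n)
      have iff: "r n * (est n \<omega> - rate) \<le> x \<longleftrightarrow> scaled_deficit_sum D n \<omega> \<le> b n"
        if "\<omega> \<in> space M" "\<omega> \<notin> bad n \<union> V" for \<omega>
      proof -
        have "r n * (est n \<omega> - rate) \<le> x \<longleftrightarrow> est n \<omega> \<le> y n"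
          using elim by (simp add: y_def field_simps)
        also have "\<dots> \<longleftrightarrow> mean_sample_deficit D n \<omega> \<le> mean_deficit (y n * D n)"
          using that elim D(2) by (intro estimator_le_iff[OF est]) (auto simp: bad_def V_def)
        also have "\<dots> \<longleftrightarrow> scaled_deficit_sum D n \<omega> \<le> b n"
          unfolding b_def using D(2) elim(3) by (rule mean_sample_deficit_le_iff)
        finally show ?thesis .
      qed
      have "\<bar>F n - cdf (\<mu> n) (b n)\<bar> \<le> prob (bad n \<union> V)"
        unfolding F cdf by (rule abs_prob_diff_le) (measurable, use iff in auto)
      also have "\<dots> \<le> prob (bad n) + prob V" by (rule measure_Un_le) auto
      also have "prob V = 0" unfolding V_def by (rule V0_square_prob)
      finally show ?case by simp
    qed
  qed
  ultimately have "(\<lambda>n. cdf (\<mu> n) (b n) + (F n - cdf (\<mu> n) (b n))) \<longlonglongrightarrow> cdf std_normal_distribution (2 / 3 * x / k) + 0"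
    by (rule tendsto_add)
  \<comment> \<open>The limiting standard deviations match because
    \<open>8 / 15 = (2 / 3)\<^sup>2 * (6 / 5)\<close>.\<close>
  moreover have "2 / 3 * x / k = x / sqrt (6 / 5 * rate)"
  proof -
    have "k = sqrt ((2 / 3)\<^sup>2 * (6 / 5 * rate))" by (simp add: k_def power2_eq_square)
    also have "\<dots> = 2 / 3 * sqrt (6 / 5 * rate)" by (subst real_sqrt_mult) simp
    finally show ?thesis using rate_pos by (simp add: field_simps)
  qed
  moreover have "cdf (density lborel (normal_density 0 (sqrt (6 / 5 * rate)))) x = cdf std_normal_distribution (x / sqrt (6 / 5 * rate))"
    using rate_pos by (intro cdf_normal_eq_std) auto
  ultimately show "(\<lambda>n. cdf (distr M borel (\<lambda>\<omega>. sqrt (real n * D n) * (est n \<omega> - rate))) x) \<longlonglongrightarrow>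
      cdf (density lborel (normal_density 0 (sqrt (6 / 5 * rate)))) x"
    by (simp add: F_def r_def)
qed

end

theorem theorem3p1:
  fixes M :: "'a measure" and v lam0 :: real
    and N :: "real \<Rightarrow> 'a \<Rightarrow> nat" and V0 :: "'a \<Rightarrow> real" and X :: "real \<Rightarrow> 'a \<Rightarrow> real"
    and \<Delta> :: "nat \<Rightarrow> real" and \<eta> :: "nat \<Rightarrow> nat \<Rightarrow> 'a \<Rightarrow> real" and est :: "nat \<Rightarrow> 'a \<Rightarrow> real"
  assumes telegraph: "telegraph_process M lam0 N v V0 X"
    and Delta_pos: "\<And>n. n \<ge> 1 \<Longrightarrow> \<Delta> n > 0"
    and eta: "\<And>n i \<omega>. \<eta> n i \<omega> = X (real i * \<Delta> n) \<omega> - X ((real i - 1) * \<Delta> n) \<omega>"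
    and estimator: "\<And>n. n \<ge> 1 \<Longrightarrow> moment_type_estimator M v (\<Delta> n) n (\<eta> n) (est n)"
    and n_Delta: "filterlim (\<lambda>n. real n * \<Delta> n) at_top sequentially"
    and Delta_lim: "\<Delta> \<longlonglongrightarrow> 0"
  shows "consistent_estimator M est lam0 \<and>
    weak_conv_m (\<lambda>n. distr M borel (\<lambda>\<omega>. sqrt (real n * \<Delta> n) * (est n \<omega> - lam0)))
      (density lborel (normal_density 0 (sqrt (6 / 5 * lam0))))"
proof -
  interpret telegraph_process M lam0 N v V0 X by (rule telegraph)
  \<comment> \<open>Nothing is assumed about the values at \<open>n = 0\<close>.\<close>
  define D where "D n = (if n = 0 then 1 else \<Delta> n)" for n
  define T where "T n = (if n = 0 then (\<lambda>_. 0) else est n)" for n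
  let ?\<nu> = "density lborel (normal_density 0 (sqrt (6 / 5 * lam0)))"
  have Dpos: "0 < D n" for n using Delta_pos by (simp add: D_def)
  have nD: "real n * D n = real n * \<Delta> n" for n by (simp add: D_def)
  have Dlim: "D \<longlonglongrightarrow> 0"
    by (rule Lim_transform_eventually[OF Delta_lim])
       (use eventually_ge_at_top[of 1] in \<open>eventually_elim, simp add: D_def\<close>)
  have T: "T n \<in> borel_measurable M" for n
    using estimator[of n] by (simp add: T_def moment_type_estimator_def)
  have est: "moment_type_estimator M v (D n) n (\<lambda>i \<omega>. X (real i * D n) \<omega> - X ((real i - 1) * D n) \<omega>) (T n)"
    if "n \<ge> 1" for n
  proof -
    have "\<eta> n = (\<lambda>i \<omega>. X (real i * D n) \<omega> - X ((real i - 1) * D n) \<omega>)"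
      using that by (intro ext) (simp add: eta D_def)
    then show ?thesis using estimator[OF that] that by (simp add: D_def T_def)
  qed
  have wc: "weak_conv_m (\<lambda>n. distr M borel (\<lambda>\<omega>. sqrt (real n * \<Delta> n) * (T n \<omega> - lam0))) ?\<nu>"
    using estimator_weak_conv[OF Dlim Dpos _ est T] n_Delta unfolding nD by simp
  have s: "sqrt (6 / 5 * lam0) > 0" using rate_pos by simp
  have "consistent_estimator M T lam0"
    by (rule consistent_estimator_of_weak_conv[OF T wc real_distribution_normal[OF s] isCont_cdf_normal[OF s]
        filterlim_compose[OF sqrt_at_top n_Delta]])
  then have "consistent_estimator M est lam0"
    unfolding consistent_estimator_def
  proof (elim all_forward imp_forward)
    fix \<epsilon> assume "(\<lambda>n. prob {\<omega> \<in> space M. \<bar>T n \<omega> - lam0\<bar> > \<epsilon>}) \<longlonglongrightarrow> 0"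
    then show "(\<lambda>n. prob {\<omega> \<in> space M. \<bar>est n \<omega> - lam0\<bar> > \<epsilon>}) \<longlonglongrightarrow> 0"
      by (rule Lim_transform_eventually)
         (use eventually_ge_at_top[of 1] in \<open>eventually_elim, simp add: T_def\<close>)
  qed
  moreover have "weak_conv_m (\<lambda>n. distr M borel (\<lambda>\<omega>. sqrt (real n * \<Delta> n) * (est n \<omega> - lam0))) ?\<nu>"
    unfolding weak_conv_m_def weak_conv_def
  proof (intro allI impI)
    fix x assume "isCont (cdf ?\<nu>) x"
    then have "(\<lambda>n. cdf (distr M borel (\<lambda>\<omega>. sqrt (real n * \<Delta> n) * (T n \<omega> - lam0))) x) \<longlonglongrightarrow> cdf ?\<nu> x"
      using wc by (simp add: weak_conv_m_def weak_conv_def)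
    then show "(\<lambda>n. cdf (distr M borel (\<lambda>\<omega>. sqrt (real n * \<Delta> n) * (est n \<omega> - lam0))) x) \<longlonglongrightarrow> cdf ?\<nu> x"
      by (rule Lim_transform_eventually)
         (use eventually_ge_at_top[of 1] in \<open>eventually_elim, simp add: T_def\<close>)
  qed
  ultimately show ?thesis ..
qed

end
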